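(* Let $r\ge 1$ be a fixed integer. There is a constant $C_r>0$, independent of $n$, such that for all $n\ge 1$ the spectral gap $\gamma_X$ of the leaf translation Markov chain $X$ on the set $\mathsf T^{(r)}_n$ of $r$-coloured plane trees with $n$ edges satisfies $$\gamma_X\ \ge\ C_r\, n^{-\frac92}.$$
   Context: A plane tree is a rooted planar map (connected planar multigraph embedded in the sphere up to orientation-preserving homeomorphism, with a distinguished oriented edge) with a single face; equivalently a rooted ordered tree. The tail of the root edge is the origin. The clockwise contour of a plane tree with $n$ edges is the cyclic sequence $c_1,\dots,c_{2n}$ of its corners, where $c_1$ (the root corner) is the corner of the origin immediately to the left of the root edge (so the root edge is the edge traversed first, leading to the first child of the origin). For a vertex $v$ other than the origin, $p(v)$ is its parent; every edge is uniquely of the form $(v,p(v))$. A leaf is a vertex of degree 1 other than the origin. $\mathsf T_n$ is the set of plane trees with $n$ edges, and $\mathsf T^{(r)}_n=\{(t,C): t\in\mathsf T_n,\ C\in\{1,\dots,r\}^{E(t)}\}$ is the set of plane trees with edges coloured in $\{1,\dots,r\}$. Leaf translations. Let $t\in\mathsf T^{(r)}_n$ and let $v$ be a leaf of $t$, whose unique corner is $c_l$. If $l<2n$, $t^{v,\rightarrow}$ is obtained by drawing a new leaf $v'$ attached via the corner $c_{l+2}$ (via $c_1$ if $l=2n-1$, in which case the root edge is unchanged, so $v'$ becomes the last child of the origin), and then erasing $v$; if $(p(v),v)$ was the root edge (i.e. $l=2$), the new tree is rooted in $(p(p(v')),p(v'))$. The edge of $v'$ receives the colour of the edge $(v,p(v))$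 and all other colours are preserved. If $l=2n$, $t^{v,\rightarrow}=t$. The tree $t^{v,\leftarrow}$ is obtained by the inverse operation: it is the tree such that translating the corresponding leaf $v$ of $t^{v,\leftarrow}$ to the right gives $t$, i.e. $(t^{v,\leftarrow})^{v,\rightarrow}=t$; if $(p(v),v)$ is the root edge of $t$ (the one case in which no such tree exists), $t^{v,\leftarrow}=t$. For a colour $x\in\{1,\dots,r\}$, $t^{v,x}$ is $t$ with the edge $(v,p(v))$ recoloured with colour $x$. The leaf translation chain $X$ on $\mathsf T^{(r)}_n$: given $X_k=t$, select an edge $(v,p(v))$ of $t$ uniformly at random; if $v$ is a leaf, $X_{k+1}$ is one of $t^{v,\rightarrow},t^{v,\leftarrow},t^{v,1},\dots,t^{v,r}$, each with probability $\frac1{r+2}$; if $v$ is not a leaf, $X_{k+1}=t$. This chain is reversible with respect to the uniform measure on $\mathsf T^{(r)}_n$. For a reversible irreducible chain with transition matrix $p$ and stationary measure $\pi$ on a finite set $\Omega$, the spectral gap is $\inf_f \mathcal E(f,f)/\mathrm{Var}_\pi(f)$ over non-constant $f:\Omega\to\mathbb R$, where $\mathcal E(f,f)=\frac12\sum_{x,y}(f(x)-f(y))^2\pi(x)p(x,y)$ (the infimum over the empty set being $+\infty$). *)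

theory Defs
  imports "HOL-Probability.Probability_Mass_Function"
begin

text \<open>
  A plane tree is encoded as a rooted ordered tree: the list holds the subtrees at the children in
  the order in which the clockwise contour meets them (the root edge leads to the first child of
  the origin), each with the colour of the edge joining that child to its parent.
\<close>

datatype ctree = Node (branches: "(nat \<times> ctree) list")

text \<open>
  A vertex is the list of child indices (from 0) leading to it from the origin \<open>[]\<close>.
\<close>

type_synonym vertex = "nat list"

fun is_vertex :: "ctree \<Rightarrow> vertex \<Rightarrow> bool" where
  "is_vertex t [] \<longleftrightarrow> True"
| "is_vertex (Node bs) (i # v) \<longleftrightarrow> i < length bs \<and> is_vertex (snd (bs ! i)) v"

fun subtree_at :: "ctree \<Rightarrow> vertex \<Rightarrow> ctree" where
  "subtree_at t [] = t"
| "subtree_at (Node bs) (i # v) = subtree_at (snd (bs ! i)) v"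

text \<open>The edge \<open>(v, p(v))\<close> is represented by \<open>v\<close>.\<close>

definition edges :: "ctree \<Rightarrow> vertex set" where
  "edges t = {v. is_vertex t v \<and> v \<noteq> []}"

fun edge_colour :: "ctree \<Rightarrow> vertex \<Rightarrow> nat" where
  "edge_colour t [] = undefined"
| "edge_colour (Node bs) [i] = fst (bs ! i)"
| "edge_colour (Node bs) (i # j # v) = edge_colour (snd (bs ! i)) (j # v)"

definition coloured_trees :: "nat \<Rightarrow> nat \<Rightarrow> ctree set" where
  "coloured_trees r n = {t. card (edges t) = n \<and> (\<forall>v\<in>edges t. edge_colour t v \<in> {1..r})}"

definition degree :: "ctree \<Rightarrow> vertex \<Rightarrow> nat" where
  "degree t v = length (branches (subtree_at t v)) + (if v = [] then 0 else 1)"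

definition is_leaf :: "ctree \<Rightarrow> vertex \<Rightarrow> bool" where
  "is_leaf t v \<longleftrightarrow> is_vertex t v \<and> v \<noteq> [] \<and> degree t v = 1"

text \<open>
  The corner \<open>(u, g)\<close> lies between the \<open>g\<close>-th and the next child edge of \<open>u\<close>; a new leaf attached
  through it has exactly \<open>g\<close> older siblings. The contour of a tree with \<open>n\<close> edges is listed with
  \<open>2n + 1\<close> entries, the first \<open>2n\<close> of which are its corners. If the origin has \<open>k\<close> children, the extra
  entry \<open>([], k)\<close> is the first corner \<open>([], 0)\<close> of the map once more, but a leaf attached through it
  becomes the last child of the origin, so that the root edge is unchanged.
\<close>

type_synonym corner = "vertex \<times> nat"

function contour :: "ctree \<Rightarrow> corner list" where
  "contour (Node bs) = ([], 0) # concat (map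
     (\<lambda>i. map (\<lambda>(u, g). (i # u, g)) (contour (snd (bs ! i))) @ [([], Suc i)]) [0..<length bs])"
  by pat_completeness auto
termination
proof (relation "Wellfounded.measure size", goal_cases)
  case (2 bs i)
  then have "bs ! i \<in> set bs"
    by simp
  then have "size_prod (\<lambda>_. 0) size (bs ! i) \<le> size_list (size_prod (\<lambda>_. 0) size) bs"
    by (rule size_list_estimation') simp
  then show ?case
    by (cases "bs ! i") simp
qed simp

definition nth_corner :: "ctree \<Rightarrow> nat \<Rightarrow> corner" where
  "nth_corner t l = contour t ! (l - 1)"

definition leaf_position :: "ctree \<Rightarrow> vertex \<Rightarrow> nat" where
  "leaf_position t v = (THE l. l \<in> {1..2 * card (edges t)} \<and> fst (nth_corner t l) = v)"

fun insert_leaf :: "corner \<Rightarrow> nat \<Rightarrow> ctree \<Rightarrow> ctree" where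
  "insert_leaf ([], g) c (Node bs) = Node (take g bs @ (c, Node []) # drop g bs)"
| "insert_leaf (i # u, g) c (Node bs) =
     Node (bs[i := (fst (bs ! i), insert_leaf (u, g) c (snd (bs ! i)))])"

fun erase_leaf :: "vertex \<Rightarrow> ctree \<Rightarrow> ctree" where
  "erase_leaf [] t = t"
| "erase_leaf [i] (Node bs) = Node (take i bs @ drop (Suc i) bs)"
| "erase_leaf (i # j # v) (Node bs) =
     Node (bs[i := (fst (bs ! i), erase_leaf (j # v) (snd (bs ! i)))])"

fun recolour :: "vertex \<Rightarrow> nat \<Rightarrow> ctree \<Rightarrow> ctree" where
  "recolour [] c t = t"
| "recolour [i] c (Node bs) = Node (bs[i := (c, snd (bs ! i))])"
| "recolour (i # j # v) c (Node bs) =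
     Node (bs[i := (fst (bs ! i), recolour (j # v) c (snd (bs ! i)))])"

text \<open>
  The new leaf comes later in the contour than \<open>v\<close>, so inserting it does not change the address of
  \<open>v\<close>. If \<open>(p(v), v)\<close> is the root edge, the new leaf is attached to the second child of the origin,
  which becomes the first one when \<open>v\<close> is erased; this is the prescribed rerooting.
\<close>

definition translate_right :: "ctree \<Rightarrow> vertex \<Rightarrow> ctree" where
  "translate_right t v =
     (let l = leaf_position t v
      in if l < 2 * card (edges t)
         then erase_leaf v (insert_leaf (nth_corner t (l + 2)) (edge_colour t v) t)
         else t)"

text \<open>
  A translation to the right that moves a leaf takes its corner from position \<open>l\<close> to position
  \<open>l + 1\<close>, so the leaf of \<open>t'\<close> corresponding to \<open>v\<close> is the one one position earlier. Requiring this
  also rules out \<open>t' = t\<close> when \<open>v\<close> is at position \<open>2n\<close>, where the translation to the right fixes \<open>t\<close>.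
\<close>

definition translate_left :: "ctree \<Rightarrow> vertex \<Rightarrow> ctree" where
  "translate_left t v =
     (if v = [0] then t
      else (THE t'. \<exists>v'. is_leaf t' v' \<and> leaf_position t' v' + 1 = leaf_position t v \<and>
                         translate_right t' v' = t))"

datatype move = Translate_Right | Translate_Left | Recolour nat

fun apply_move :: "move \<Rightarrow> ctree \<Rightarrow> vertex \<Rightarrow> ctree" where
  "apply_move Translate_Right t v = translate_right t v"
| "apply_move Translate_Left t v = translate_left t v"
| "apply_move (Recolour x) t v = recolour v x t"

definition moves :: "nat \<Rightarrow> move set" where
  "moves r = {Translate_Right, Translate_Left} \<union> Recolour ` {1..r}"

definition leaf_translation_chain :: "nat \<Rightarrow> ctree \<Rightarrow> ctree pmf" where
  "leaf_translation_chain r t =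
     bind_pmf (pmf_of_set (edges t)) (\<lambda>v.
       if is_leaf t v then map_pmf (\<lambda>m. apply_move m t v) (pmf_of_set (moves r))
       else return_pmf t)"

definition dirichlet_form ::
    "'a set \<Rightarrow> 'a pmf \<Rightarrow> ('a \<Rightarrow> 'a pmf) \<Rightarrow> ('a \<Rightarrow> real) \<Rightarrow> real" where
  "dirichlet_form \<Omega> \<pi> K f =
     1 / 2 * (\<Sum>x\<in>\<Omega>. \<Sum>y\<in>\<Omega>. (f x - f y)\<^sup>2 * pmf \<pi> x * pmf (K x) y)"

text \<open>
  \<open>\<Omega>\<close> is the finite state space and \<open>\<pi>\<close> the reversible measure of the transition kernel \<open>K\<close>. In the
  extended reals the infimum over the empty set is \<open>\<infinity>\<close>.
\<close>

definition spectral_gap :: "'a set \<Rightarrow> 'a pmf \<Rightarrow> ('a \<Rightarrow> 'a pmf) \<Rightarrow> ereal" where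
  "spectral_gap \<Omega> \<pi> K =
     (INF f \<in> {f :: 'a \<Rightarrow> real. \<exists>x\<in>\<Omega>. \<exists>y\<in>\<Omega>. f x \<noteq> f y}.
        ereal (dirichlet_form \<Omega> \<pi> K f / measure_pmf.variance \<pi> f))"

end

theory Submission
  imports Defs
begin

text \<open>
  Write \<open>T\<^sub>n\<close> for the set of \<open>r\<close>-coloured trees with \<open>n\<close> edges, \<open>N\<^sub>n\<close> for its size, and \<open>z \<cdot> x\<close> for the tree
  whose origin has a first branch carrying \<open>z\<close>, followed by the branches of \<open>x\<close>. The bound is a
  Poincare inequality, proved by transporting a uniform tree \<open>X\<close> of \<open>T\<^sub>n\<close> to an independent random tree
  through leaf translations, and counting how often each single move is used.

  Trees can be grown leaf by leaf so that the tree is uniform at every step: in \<open>a \<cdot> b\<close> a biased coin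
  chooses whether to grow \<open>a\<close> or \<open>b\<close>, recursively, and there is an explicit bias
  (\<open>left_prob\<close>) for which the uniform law on \<open>T\<^sub>m\<close> is carried to the uniform law on
  \<open>T\<^sub>m\<^sub>+\<^sub>1\<close> (\<open>bind_grow_uniform\<close>). Take independent growth histories \<open>X\<^sub>0, \<dots>, X\<^sub>n\<close> and \<open>Z\<^sub>0, \<dots>, Z\<^sub>n\<^sub>-\<^sub>1\<close>.
  The sequence \<open>X\<^sub>n\<close>, \<open>Z\<^sub>0 \<cdot> X\<^sub>n\<^sub>-\<^sub>1\<close>, \<open>Z\<^sub>1 \<cdot> X\<^sub>n\<^sub>-\<^sub>2\<close>, \<dots>, \<open>Z\<^sub>n\<^sub>-\<^sub>1 \<cdot> X\<^sub>0\<close> joins \<open>X\<^sub>n\<close> to a tree that does not depend on it,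
  and consecutive trees differ by the place and colour of one leaf: from \<open>Z\<^sub>k \<cdot> X\<^sub>n\<^sub>-\<^sub>1\<^sub>-\<^sub>k\<close> to
  \<open>Z\<^sub>k\<^sub>+\<^sub>1 \<cdot> X\<^sub>n\<^sub>-\<^sub>2\<^sub>-\<^sub>k\<close> a leaf of \<open>w = Z\<^sub>k \<cdot> X\<^sub>n\<^sub>-\<^sub>2\<^sub>-\<^sub>k\<close>, which has \<open>n - 1\<close> edges, is carried along the contour of
  \<open>w\<close>. By Cauchy-Schwarz the square of the increment of \<open>f\<close> is at most \<open>4 n\<close> times the
  \<open>leaf_energy\<close> of \<open>w\<close>, the sum of the squared increments of \<open>f\<close> over all elementary moves of one leaf
  added to \<open>w\<close> (\<open>square_diff_le_leaf_energy\<close>); chaining the \<open>n\<close> steps costs one more factor \<open>n\<close>.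

  Everything hinges on the form \<open>z \<cdot> x\<close> of the intermediate trees. It determines \<open>k\<close>, so a given \<open>w\<close> is
  met at one step only, and there with probability \<open>1 / (N\<^sub>k N\<^sub>n\<^sub>-\<^sub>2\<^sub>-\<^sub>k)\<close>. Since \<open>N\<^sub>n\<close> is \<open>(4 r)\<^sup>n n\<^bsup>-3/2\<^esup>\<close> up to
  constants, this exceeds the uniform weight \<open>1 / N\<^sub>n\<close> by a factor of order at most \<open>n\<^bsup>3/2\<^esup>\<close>
  (\<open>card_coloured_trees_split\<close>). A tree of \<open>T\<^sub>n\<close> and one of its leaves determine \<open>w\<close>, the place of the leaf
  and its colour, so the leaf energies add up to at most a constant times \<open>n N\<^sub>n\<close> times the Dirichlet form, where
  \<open>n\<close> accounts for the choice of the edge by the chain (\<open>sum_leaf_energy_le_dirichlet_form\<close>).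
  Altogether the variance is at most \<open>n\<^sup>2 \<cdot> n\<^bsup>3/2\<^esup> \<cdot> n = n\<^bsup>9/2\<^esup>\<close> times the Dirichlet form, up to a constant
  depending on \<open>r\<close>.
\<close>

section \<open>Plane trees as binary trees\<close>

text \<open>
  Splitting off the first branch of the origin presents a nonempty plane tree as a coloured pair of
  smaller ones. All inductions on trees below follow this binary decomposition.
\<close>

definition add_branch :: "nat \<Rightarrow> ctree \<Rightarrow> ctree \<Rightarrow> ctree" where
  "add_branch e a b = Node ((e, a) # branches b)"

lemma add_branch_inject [simp]: "add_branch e a b = add_branch e' a' b' \<longleftrightarrow> e = e' \<and> a = a' \<and> b = b'"
  by (auto simp: add_branch_def ctree.expand)

lemma add_branch_neq_Node_Nil [simp]: "add_branch e a b \<noteq> Node []" "Node [] \<noteq> add_branch e a b"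
  by (auto simp: add_branch_def)

lemma ctree_branch_induct [case_names Leaf Branch, induct type: ctree]:
  assumes leaf: "P (Node [])" and branch: "\<And>e a b. P a \<Longrightarrow> P b \<Longrightarrow> P (add_branch e a b)"
  shows "P t"
proof (induction t rule: measure_induct_rule[of size])
  case (less t)
  show ?case
  proof (cases "branches t")
    case Nil
    then show ?thesis
      using leaf by (cases t) simp
  next
    case (Cons x bs)
    obtain e a where x: "x = (e, a)"
      by (cases x)
    have t: "t = add_branch e a (Node bs)"
      using Cons x by (cases t) (simp add: add_branch_def)
    have "P a" "P (Node bs)"
      using less.IH[of a] less.IH[of "Node bs"] by (simp_all add: t add_branch_def)
    then show ?thesis
      unfolding t by (rule branch)
  qed
qed

lemma ctree_branch_cases [case_names Leaf Branch, cases type: ctree]: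
  obtains "t = Node []" | e a b where "t = add_branch e a b"
  by (induction t) auto

fun num_edges :: "ctree \<Rightarrow> nat" where
  "num_edges (Node []) = 0"
| "num_edges (Node ((e, a) # bs)) = Suc (num_edges a + num_edges (Node bs))"

fun colours :: "ctree \<Rightarrow> nat set" where
  "colours (Node []) = {}"
| "colours (Node ((e, a) # bs)) = insert e (colours a \<union> colours (Node bs))"

lemma num_edges_add_branch [simp]: "num_edges (add_branch e a b) = Suc (num_edges a + num_edges b)"
  by (cases b rule: ctree.exhaust) (simp add: add_branch_def)

lemma colours_add_branch [simp]: "colours (add_branch e a b) = insert e (colours a \<union> colours b)"
  by (cases b rule: ctree.exhaust) (simp add: add_branch_def)

lemma num_edges_eq_0 [simp]: "num_edges t = 0 \<longleftrightarrow> t = Node []"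
  by (cases t) auto

text \<open>
  When a new first branch is added at the origin, the addresses of the vertices already present
  change by \<open>shift_vertex\<close> and their corners by \<open>shift_corner\<close>; the corners of the new branch
  \<open>a\<close>, seen from the origin, are obtained by \<open>descend_corner\<close>. The root corner of the old tree becomes the
  corner just after the new branch.
\<close>

fun shift_vertex :: "vertex \<Rightarrow> vertex" where
  "shift_vertex [] = []"
| "shift_vertex (i # v) = Suc i # v"

fun shift_corner :: "corner \<Rightarrow> corner" where
  "shift_corner ([], g) = ([], Suc g)"
| "shift_corner (i # u, g) = (Suc i # u, g)"

definition descend_corner :: "corner \<Rightarrow> corner" where
  "descend_corner q = (0 # fst q, snd q)"

lemma shift_vertex_eq_Nil [simp]: "shift_vertex v = [] \<longleftrightarrow> v = []"
  by (cases v) auto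

lemma Nil_eq_shift_vertex [simp]: "[] = shift_vertex v \<longleftrightarrow> v = []"
  by (cases v) auto

lemma shift_vertex_inject [simp]: "shift_vertex u = shift_vertex v \<longleftrightarrow> u = v"
  by (cases u; cases v) auto

lemma shift_vertex_neq_0_Cons [simp]: "shift_vertex u \<noteq> 0 # v" "0 # v \<noteq> shift_vertex u"
  by (cases u; simp)+

lemma fst_shift_corner [simp]: "fst (shift_corner q) = shift_vertex (fst q)"
  by (cases q rule: shift_corner.cases) auto

lemma fst_descend_corner [simp]: "fst (descend_corner q) = 0 # fst q"
  by (simp add: descend_corner_def)

lemma contour_leaf [simp]: "contour (Node []) = [([], 0)]"
  by simp

lemma contour_add_branch:
  "contour (add_branch e a b) = ([], 0) # map descend_corner (contour a) @ map shift_corner (contour b)"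
proof (cases b rule: ctree.exhaust)
  case (Node bs)
  have descend_corner: "(\<lambda>(u, g). (0 # u, g)) = descend_corner"
    by (auto simp: descend_corner_def)
  have "map (\<lambda>i. map (\<lambda>(u, g). (i # u, g)) (contour (snd (((e, a) # bs) ! i))) @ [([], Suc i)])
          [0..<length ((e, a) # bs)]
      = (map descend_corner (contour a) @ [([], Suc 0)]) #
        map (\<lambda>i. map shift_corner (map (\<lambda>(u, g). (i # u, g)) (contour (snd (bs ! i))) @ [([], Suc i)]))
          [0..<length bs]"
    by (simp add: upt_conv_Cons map_Suc_upt[symmetric] descend_corner comp_def case_prod_beta
        del: upt_Suc contour.simps)
  then show ?thesis
    by (simp add: add_branch_def Node map_concat comp_def del: upt_Suc)
qed

declare contour.simps [simp del]

lemma length_contour [simp]: "length (contour t) = Suc (2 * num_edges t)"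
  by (induction t) (simp_all add: contour_add_branch)

lemma nth_contour_0 [simp]: "contour t ! 0 = ([], 0)"
  by (cases t) (simp_all add: contour_add_branch)

lemma nth_contour_in_branch:
  "p \<le> 2 * num_edges a \<Longrightarrow> contour (add_branch e a b) ! Suc p = descend_corner (contour a ! p)"
  by (simp add: contour_add_branch nth_append)

lemma nth_contour_after_branch:
  "p \<le> 2 * num_edges b \<Longrightarrow>
    contour (add_branch e a b) ! Suc (Suc (2 * num_edges a + p)) = shift_corner (contour b ! p)"
  by (simp add: contour_add_branch nth_append)

lemma contour_index_cases:
  assumes "p \<le> 2 * num_edges (add_branch e a b)"
  obtains "p = 0"
    | q where "p = Suc q" "q \<le> 2 * num_edges a"
    | q where "p = Suc (Suc (2 * num_edges a + q))" "q \<le> 2 * num_edges b"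
proof -
  consider "p = 0" | "0 < p" "p - 1 \<le> 2 * num_edges a" | "2 * num_edges a < p - 1"
    by linarith
  then show ?thesis
  proof cases
    case 2
    then show ?thesis using that(2)[of "p - 1"] by simp
  next
    case 3
    then show ?thesis using that(3)[of "p - 2 - 2 * num_edges a"] assms by simp
  qed (use that in blast)
qed

lemma is_vertex_add_branch [simp]:
  "is_vertex (add_branch e a b) (0 # v) \<longleftrightarrow> is_vertex a v"
  "is_vertex (add_branch e a b) (shift_vertex v) \<longleftrightarrow> is_vertex b v"
   apply (simp add: add_branch_def)
  apply (cases b rule: ctree.exhaust; cases v; simp add: add_branch_def)
  done

lemma branch_vertex_cases:
  obtains "v = []" | u where "v = 0 # u" | u where "v = shift_vertex u" "u \<noteq> []"
proof (cases v)
  case (Cons i u)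
  then show ?thesis
    using that(2)[of u] that(3)[of "(i - 1) # u"] by (cases i) auto
qed (use that in blast)

lemma edges_leaf [simp]: "edges (Node []) = {}"
proof -
  have "\<not> is_vertex (Node []) v" if "v \<noteq> []" for v
    using that by (cases v) auto
  then show ?thesis by (auto simp: edges_def)
qed

lemma edges_add_branch:
  "edges (add_branch e a b) = insert [0] ((#) 0 ` edges a \<union> shift_vertex ` edges b)"
proof (rule set_eqI)
  fix v
  show "v \<in> edges (add_branch e a b) \<longleftrightarrow> v \<in> insert [0] ((#) 0 ` edges a \<union> shift_vertex ` edges b)"
    by (cases v rule: branch_vertex_cases)
      (auto simp: edges_def image_iff)
qed

lemma finite_edges [simp]: "finite (edges t)"
  by (induction t) (simp_all add: edges_add_branch)

lemma card_edges [simp]: "card (edges t) = num_edges t"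
proof (induction t)
  case (Branch e a b)
  have "card (edges (add_branch e a b)) = Suc (card ((#) 0 ` edges a \<union> shift_vertex ` edges b))"
    unfolding edges_add_branch by (subst card_insert_disjoint) (auto, simp add: edges_def)
  also have "card ((#) 0 ` edges a \<union> shift_vertex ` edges b) = card ((#) 0 ` edges a) + card (shift_vertex ` edges b)"
    by (rule card_Un_disjoint) auto
  also have "\<dots> = num_edges a + num_edges b"
    using Branch by (simp add: card_image inj_on_def)
  finally show ?case by simp
qed simp

lemma edge_colour_add_branch [simp]:
  "edge_colour (add_branch e a b) [0] = e"
  "v \<noteq> [] \<Longrightarrow> edge_colour (add_branch e a b) (0 # v) = edge_colour a v"
  "v \<noteq> [] \<Longrightarrow> edge_colour (add_branch e a b) (shift_vertex v) = edge_colour b v"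
    apply (simp add: add_branch_def)
   apply (cases v; simp add: add_branch_def)
  apply (cases b rule: ctree.exhaust; cases v rule: edge_colour.cases[of "(b,v)" for v, simplified]; simp add: add_branch_def)
  done

section \<open>Adding a leaf at a corner\<close>

lemma insert_leaf_add_branch:
  "insert_leaf ([], 0) c t = add_branch c (Node []) t"
  "insert_leaf (descend_corner q) c (add_branch e a b) = add_branch e (insert_leaf q c a) b"
  "insert_leaf (shift_corner q) c (add_branch e a b) = add_branch e a (insert_leaf q c b)"
  subgoal by (cases t rule: ctree.exhaust) (simp add: add_branch_def)
  subgoal by (cases q; cases b rule: ctree.exhaust) (simp add: add_branch_def descend_corner_def)
  subgoal by (cases q rule: shift_corner.cases; cases b rule: ctree.exhaust) (simp_all add: add_branch_def)
  done

text \<open>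
  The position \<open>p\<close> counts contour entries from \<open>0\<close>, and \<open>p = 2 m\<close> is the extra last entry when \<open>t\<close> has
  \<open>m\<close> edges. Hence a new leaf has \<open>2 m + 1\<close> places, linearly ordered along the contour, and translating it
  to the right moves it to the next place.
\<close>

definition grow_at :: "nat \<Rightarrow> nat \<Rightarrow> ctree \<Rightarrow> ctree" where
  "grow_at p c t = insert_leaf (contour t ! p) c t"

lemma grow_at_0: "grow_at 0 c t = add_branch c (Node []) t"
  by (simp add: grow_at_def insert_leaf_add_branch)

lemma grow_at_in_branch:
  "p \<le> 2 * num_edges a \<Longrightarrow> grow_at (Suc p) c (add_branch e a b) = add_branch e (grow_at p c a) b"
  by (simp add: grow_at_def insert_leaf_add_branch nth_contour_in_branch)

lemma grow_at_after_branch: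
  "p \<le> 2 * num_edges b \<Longrightarrow>
    grow_at (Suc (Suc (2 * num_edges a + p))) c (add_branch e a b) = add_branch e a (grow_at p c b)"
  by (simp add: grow_at_def insert_leaf_add_branch nth_contour_after_branch)

lemmas grow_at_simps = grow_at_0 grow_at_in_branch grow_at_after_branch

definition new_vertex :: "nat \<Rightarrow> ctree \<Rightarrow> vertex" where
  "new_vertex p t = fst (contour t ! p) @ [snd (contour t ! p)]"

lemma new_vertex_0: "new_vertex 0 t = [0]"
  by (simp add: new_vertex_def)

lemma new_vertex_in_branch:
  "p \<le> 2 * num_edges a \<Longrightarrow> new_vertex (Suc p) (add_branch e a b) = 0 # new_vertex p a"
  by (simp add: new_vertex_def nth_contour_in_branch descend_corner_def)

lemma new_vertex_after_branch:
  "p \<le> 2 * num_edges b \<Longrightarrow>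
    new_vertex (Suc (Suc (2 * num_edges a + p))) (add_branch e a b) = shift_vertex (new_vertex p b)"
  by (cases "contour b ! p" rule: shift_corner.cases)
    (simp_all add: new_vertex_def nth_contour_after_branch)

lemmas new_vertex_simps = new_vertex_0 new_vertex_in_branch new_vertex_after_branch

lemma new_vertex_neq_Nil [simp]: "new_vertex p t \<noteq> []"
  by (simp add: new_vertex_def)

lemma grow_at_induct [consumes 1, case_names First Left Right]:
  assumes "p \<le> 2 * num_edges t"
    and "\<And>t. P 0 t"
    and "\<And>p e a b. p \<le> 2 * num_edges a \<Longrightarrow> P p a \<Longrightarrow> P (Suc p) (add_branch e a b)"
    and "\<And>p e a b. p \<le> 2 * num_edges b \<Longrightarrow> P p b \<Longrightarrow>
           P (Suc (Suc (2 * num_edges a + p))) (add_branch e a b)"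
  shows "P p t"
  using assms(1)
proof (induction t arbitrary: p)
  case Leaf
  then show ?case using assms(2) by simp
next
  case (Branch e a b)
  from Branch.prems show ?case
    by (cases rule: contour_index_cases) (use assms(2-4) Branch.IH in auto)
qed

lemma num_edges_grow_at: "p \<le> 2 * num_edges t \<Longrightarrow> num_edges (grow_at p c t) = Suc (num_edges t)"
  by (induction p t rule: grow_at_induct) (simp_all add: grow_at_simps)

lemma colours_grow_at: "p \<le> 2 * num_edges t \<Longrightarrow> colours (grow_at p c t) = insert c (colours t)"
  by (induction p t rule: grow_at_induct) (auto simp: grow_at_simps)

lemma erase_leaf_add_branch:
  "erase_leaf [0] (add_branch e (Node []) t) = t"
  "v \<noteq> [] \<Longrightarrow> erase_leaf (0 # v) (add_branch e a b) = add_branch e (erase_leaf v a) b"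
  "v \<noteq> [] \<Longrightarrow> erase_leaf (shift_vertex v) (add_branch e a b) = add_branch e a (erase_leaf v b)"
  subgoal by (cases t rule: ctree.exhaust) (simp add: add_branch_def)
  subgoal by (cases v; cases b rule: ctree.exhaust) (simp_all add: add_branch_def)
  subgoal by (cases b rule: ctree.exhaust; cases "(v, b)" rule: erase_leaf.cases) (simp_all add: add_branch_def)
  done

lemma recolour_add_branch:
  "recolour [0] c (add_branch e a b) = add_branch c a b"
  "v \<noteq> [] \<Longrightarrow> recolour (0 # v) c (add_branch e a b) = add_branch e (recolour v c a) b"
  "v \<noteq> [] \<Longrightarrow> recolour (shift_vertex v) c (add_branch e a b) = add_branch e a (recolour v c b)"
  subgoal by (cases b rule: ctree.exhaust) (simp add: add_branch_def)
  subgoal by (cases v; cases b rule: ctree.exhaust) (simp_all add: add_branch_def)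
  subgoal by (cases b rule: ctree.exhaust; cases "(v, c, b)" rule: recolour.cases) (simp_all add: add_branch_def)
  done

lemma subtree_at_add_branch:
  "subtree_at (add_branch e a b) (0 # v) = subtree_at a v"
  "v \<noteq> [] \<Longrightarrow> subtree_at (add_branch e a b) (shift_vertex v) = subtree_at b v"
  subgoal by (simp add: add_branch_def)
  subgoal by (cases b rule: ctree.exhaust; cases v) (simp_all add: add_branch_def)
  done

lemma erase_new_vertex:
  "p \<le> 2 * num_edges t \<Longrightarrow> erase_leaf (new_vertex p t) (grow_at p c t) = t"
  by (induction p t rule: grow_at_induct)
    (simp_all add: grow_at_simps new_vertex_simps erase_leaf_add_branch)

lemma recolour_new_vertex:
  "p \<le> 2 * num_edges t \<Longrightarrow> recolour (new_vertex p t) c' (grow_at p c t) = grow_at p c' t"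
  by (induction p t rule: grow_at_induct)
    (simp_all add: grow_at_simps new_vertex_simps recolour_add_branch)

lemma colour_new_vertex:
  "p \<le> 2 * num_edges t \<Longrightarrow> edge_colour (grow_at p c t) (new_vertex p t) = c"
  by (induction p t rule: grow_at_induct) (simp_all add: grow_at_simps new_vertex_simps)

lemma is_leaf_new_vertex:
  assumes "p \<le> 2 * num_edges t"
  shows "is_leaf (grow_at p c t) (new_vertex p t)"
proof -
  have "is_vertex (grow_at p c t) (new_vertex p t)"
    using assms by (induction p t rule: grow_at_induct)
      (simp_all add: grow_at_simps new_vertex_simps del: is_vertex.simps(2))
  moreover have "subtree_at (grow_at p c t) (new_vertex p t) = Node []"
    using assms by (induction p t rule: grow_at_induct)
      (simp_all add: grow_at_simps new_vertex_simps subtree_at_add_branch)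
  ultimately show ?thesis
    by (simp add: is_leaf_def degree_def)
qed

text \<open>
  The contour of the grown tree follows that of \<open>t\<close> up to and including entry \<open>p\<close>, then visits the new leaf,
  which is why its only corner is entry \<open>p + 1\<close>.
\<close>

lemma fst_contour_eq_new_vertex_iff:
  assumes "p \<le> 2 * num_edges t" and "j \<le> 2 * num_edges (grow_at p c t)"
  shows "fst (contour (grow_at p c t) ! j) = new_vertex p t \<longleftrightarrow> j = Suc p"
  using assms
proof (induction p t arbitrary: j rule: grow_at_induct)
  case (First t)
  show ?case
    using First
    by (cases rule: contour_index_cases[of j c "Node []" t, unfolded grow_at_0[symmetric]])
      (simp_all add: grow_at_0 new_vertex_0 nth_contour_in_branch
        nth_contour_after_branch[where a = "Node []", simplified])
next
  case (Left p e a b)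
  note g = grow_at_in_branch[OF Left.hyps(1)]
  from Left.prems have "j \<le> 2 * num_edges (add_branch e (grow_at p c a) b)"
    by (simp add: g)
  then show ?case
  proof (cases rule: contour_index_cases)
    case (3 q)
    then show ?thesis
      using nth_contour_after_branch[of q b e "grow_at p c a"] Left.hyps(1)
      unfolding g new_vertex_in_branch[OF Left.hyps(1)]
      by (simp add: num_edges_grow_at)
  qed (use Left in \<open>simp_all add: g new_vertex_simps nth_contour_in_branch\<close>)
next
  case (Right p e a b)
  note g = grow_at_after_branch[OF Right.hyps(1)]
  from Right.prems have "j \<le> 2 * num_edges (add_branch e a (grow_at p c b))"
    by (simp add: g)
  then show ?case
    by (cases rule: contour_index_cases)
      (use Right in \<open>simp_all add: g new_vertex_simps nth_contour_in_branch nth_contour_after_branch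
         num_edges_grow_at\<close>)
qed

lemma leaf_position_new_vertex:
  assumes "p \<le> 2 * num_edges t"
  shows "leaf_position (grow_at p c t) (new_vertex p t) = p + 2"
  unfolding leaf_position_def
proof (rule the_equality)
  show "p + 2 \<in> {1..2 * card (edges (grow_at p c t))} \<and>
      fst (nth_corner (grow_at p c t) (p + 2)) = new_vertex p t"
    using fst_contour_eq_new_vertex_iff[OF assms, of "Suc p" c] assms
    by (simp add: nth_corner_def num_edges_grow_at)
next
  fix l
  assume "l \<in> {1..2 * card (edges (grow_at p c t))} \<and>
      fst (nth_corner (grow_at p c t) l) = new_vertex p t"
  then show "l = p + 2"
    using fst_contour_eq_new_vertex_iff[OF assms, of "l - 1" c]
    by (auto simp: nth_corner_def)
qed

text \<open>
  In the grown tree, entry \<open>p + 2\<close> returns to the parent of the new leaf, and entry \<open>p + 3\<close> is the corner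
  that follows \<open>p\<close> in the contour of \<open>t\<close>, with its address in the grown tree.
  This is the corner through which a translation to the right attaches the leaf.
\<close>

lemma erase_insert_after_new_vertex:
  assumes "p < 2 * num_edges t"
  shows "erase_leaf (new_vertex p t)
      (insert_leaf (contour (grow_at p c t) ! (p + 3)) c' (grow_at p c t)) = grow_at (Suc p) c' t"
proof -
  have "p \<le> 2 * num_edges t" using assms by simp
  then show ?thesis using assms
  proof (induction p t rule: grow_at_induct)
    case (First t)
    then obtain e a b where t: "t = add_branch e a b"
      by (cases t) auto
    have "contour (grow_at 0 c t) ! 3 = shift_corner (contour t ! 1)"
      using nth_contour_after_branch[of 1 t c "Node []"] First
      by (simp add: grow_at_0 numeral_3_eq_3)
    then show ?case
      by (simp add: grow_at_0 new_vertex_0 insert_leaf_add_branch erase_leaf_add_branch)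
        (simp add: grow_at_def)
  next
    case (Left p e a b)
    note g = grow_at_in_branch[OF Left.hyps(1)]
    show ?case
    \<comment> \<open>At the last corner of the first branch the leaf leaves the branch for the origin.\<close>
    proof (cases "p = 2 * num_edges a")
      case True
      have "contour (add_branch e (grow_at p c a) b) ! (Suc p + 3) = shift_corner (contour b ! 0)"
        using nth_contour_after_branch[of 0 b e "grow_at p c a"] True
        by (simp add: num_edges_grow_at numeral_3_eq_3)
      moreover have "grow_at (Suc (Suc p)) c' (add_branch e a b) = add_branch e a (grow_at 0 c' b)"
        using grow_at_after_branch[of 0 b a] True by simp
      ultimately show ?thesis
        using Left.hyps(1)
        by (simp only: g new_vertex_simps insert_leaf_add_branch erase_leaf_add_branch
            new_vertex_neq_Nil not_False_eq_True erase_new_vertex)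
          (simp add: grow_at_def)
    next
      case False
      then have p: "p < 2 * num_edges a" using Left.hyps(1) by simp
      have "contour (add_branch e (grow_at p c a) b) ! (Suc p + 3) = descend_corner (contour (grow_at p c a) ! (p + 3))"
        using nth_contour_in_branch[of "p + 3" "grow_at p c a" e b] p
        by (simp add: num_edges_grow_at)
      then show ?thesis
        using Left.IH[OF p] Left.hyps(1) p
        by (simp add: g new_vertex_simps insert_leaf_add_branch erase_leaf_add_branch
            grow_at_in_branch)
    qed
  next
    case (Right p e a b)
    note g = grow_at_after_branch[OF Right.hyps(1)]
    have p: "p < 2 * num_edges b" using Right.prems by simp
    have "contour (add_branch e a (grow_at p c b)) ! (Suc (Suc (2 * num_edges a + p)) + 3)
        = shift_corner (contour (grow_at p c b) ! (p + 3))"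
      using nth_contour_after_branch[of "p + 3" "grow_at p c b" e a] p
      by (simp add: num_edges_grow_at)
    then show ?case
      using Right.IH[OF p] Right.hyps(1) p grow_at_after_branch[of "Suc p" b a c' e]
      by (simp add: g new_vertex_simps insert_leaf_add_branch erase_leaf_add_branch)
  qed
qed

lemma translate_right_new_vertex:
  assumes "p < 2 * num_edges t"
  shows "translate_right (grow_at p c t) (new_vertex p t) = grow_at (Suc p) c t"
proof -
  have p: "p \<le> 2 * num_edges t" using assms by simp
  show ?thesis
    using assms erase_insert_after_new_vertex[OF assms]
    by (simp add: translate_right_def leaf_position_new_vertex[OF p] colour_new_vertex[OF p]
        num_edges_grow_at[OF p] nth_corner_def numeral_3_eq_3)
qed

section \<open>The state space\<close>

lemma mem_coloured_trees: "t \<in> coloured_trees r n \<longleftrightarrow> num_edges t = n \<and> colours t \<subseteq> {1..r}"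
proof -
  have "(\<forall>v\<in>edges t. edge_colour t v \<in> {1..r}) \<longleftrightarrow> colours t \<subseteq> {1..r}"
  proof (induction t)
    case (Branch e a b)
    have "(\<forall>v\<in>edges (add_branch e a b). edge_colour (add_branch e a b) v \<in> {1..r}) \<longleftrightarrow>
       e \<in> {1..r} \<and> (\<forall>v\<in>edges a. edge_colour a v \<in> {1..r}) \<and> (\<forall>v\<in>edges b. edge_colour b v \<in> {1..r})"
      unfolding edges_add_branch ball_Un ball_simps(7) ball_simps(9)
      by (intro arg_cong2[where f="(\<and>)"] ball_cong refl) (auto simp: edges_def)
    then show ?case
      using Branch by auto
  qed simp
  then show ?thesis
    by (simp add: coloured_trees_def)
qed

lemma coloured_trees_0 [simp]: "coloured_trees r 0 = {Node []}"
  by (auto simp: mem_coloured_trees)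

lemma finite_coloured_trees [simp]: "finite (coloured_trees r n)"
proof (induction n rule: less_induct)
  case (less n)
  show ?case
  proof (cases n)
    case (Suc m)
    have "coloured_trees r n \<subseteq>
        (\<lambda>(e, a, b). add_branch e a b) ` ({1..r} \<times> (\<Union>k\<le>m. coloured_trees r k) \<times> (\<Union>k\<le>m. coloured_trees r k))"
    proof
      fix t assume t: "t \<in> coloured_trees r n"
      show "t \<in> (\<lambda>(e, a, b). add_branch e a b) `
          ({1..r} \<times> (\<Union>k\<le>m. coloured_trees r k) \<times> (\<Union>k\<le>m. coloured_trees r k))"
        using t Suc by (cases t) (auto simp: mem_coloured_trees image_iff)
    qed
    then show ?thesis
      by (rule finite_subset) (use less Suc in \<open>auto simp: less_Suc_eq_le\<close>)
  qed simp
qed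

lemma grow_at_mem_coloured_trees:
  "\<lbrakk>t \<in> coloured_trees r n; p \<le> 2 * n; c \<in> {1..r}\<rbrakk> \<Longrightarrow> grow_at p c t \<in> coloured_trees r (Suc n)"
  by (auto simp: mem_coloured_trees num_edges_grow_at colours_grow_at)

lemma coloured_trees_nonempty:
  assumes "r \<ge> 1"
  shows "coloured_trees r n \<noteq> {}"
proof (induction n)
  case (Suc n)
  then show ?case
    using grow_at_mem_coloured_trees[of _ r n 0 1] assms by force
qed simp

section \<open>Growing a uniform tree leaf by leaf\<close>

text \<open>
  The probability that a tree whose first branch carries \<open>i\<close> edges and whose other branches have \<open>j\<close> edges
  in all grows inside its first branch. It is found by solving for the transition that preserves uniformity.
  Let \<open>n = i + j\<close>, let \<open>c\<^sub>m\<close> be \<open>growth_ratio m\<close>, the quotient of two consecutive Catalan numbers, and let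
  \<open>prune_prob i j\<close> be the probability that the reversed process removes a leaf from the first branch. Then
  Bayes' rule forces \<open>left_prob i j = prune_prob (i + 1) j c\<^sub>i / c\<^sub>n\<^sub>+\<^sub>1\<close>, and since both kinds of
  probabilities must add up to one, \<open>prune_prob\<close> can be computed by recursion on \<open>i\<close>; the closed
  forms are those used here.
\<close>

definition left_prob :: "nat \<Rightarrow> nat \<Rightarrow> real" where
  "left_prob i j = (real i + 1) * (real i + 3 * real j + 3) * (2 * real i + 1) /
     ((real i + real j + 1) * (real i + real j + 2) * (2 * real i + 2 * real j + 3))"

definition growth_ratio :: "nat \<Rightarrow> real" where
  "growth_ratio m = (4 * real m + 2) / (real m + 2)"

lemma left_prob_complement: "left_prob j i = 1 - left_prob i j"
proof -
  define x y where "x = real i" and "y = real j"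
  have "0 \<le> x" "0 \<le> y" by (simp_all add: x_def y_def)
  then have "(x + y + 1) * (x + y + 2) * (2 * x + 2 * y + 3) > 0"
    by simp
  moreover have "(x + 1) * (x + 3 * y + 3) * (2 * x + 1) + (y + 1) * (y + 3 * x + 3) * (2 * y + 1)
      = (x + y + 1) * (x + y + 2) * (2 * x + 2 * y + 3)"
    by algebra
  ultimately show ?thesis
    unfolding left_prob_def x_def[symmetric] y_def[symmetric]
    by (simp add: field_simps)
qed

lemma left_prob_bounds: "0 \<le> left_prob i j" "left_prob i j \<le> 1"
proof -
  have nonneg: "0 \<le> left_prob i j" for i j
    by (simp add: left_prob_def)
  show "0 \<le> left_prob i j" "left_prob i j \<le> 1"
    using nonneg[of i j] nonneg[of j i] by (simp_all add: left_prob_complement[of j i])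
qed

fun grow :: "nat \<Rightarrow> ctree \<Rightarrow> ctree pmf" where
  "grow r (Node []) = map_pmf (\<lambda>c. add_branch c (Node []) (Node [])) (pmf_of_set {1..r})"
| "grow r (Node ((e, a) # bs)) =
     bind_pmf (bernoulli_pmf (left_prob (num_edges a) (num_edges (Node bs)))) (\<lambda>left.
       if left then map_pmf (\<lambda>a'. add_branch e a' (Node bs)) (grow r a)
       else map_pmf (add_branch e a) (grow r (Node bs)))"

lemma grow_add_branch:
  "grow r (add_branch e a b) = bind_pmf (bernoulli_pmf (left_prob (num_edges a) (num_edges b))) (\<lambda>left.
       if left then map_pmf (\<lambda>a'. add_branch e a' b) (grow r a) else map_pmf (add_branch e a) (grow r b))"
proof -
  have "add_branch e a b = Node ((e, a) # branches b)" "Node (branches b) = b"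
    by (simp_all add: add_branch_def)
  then show ?thesis
    using grow.simps(2)[of r e a "branches b"] by (simp only:)
qed

lemma grow_is_grow_at:
  assumes "r \<ge> 1" "x \<in> set_pmf (grow r w)"
  obtains p c where "p \<le> 2 * num_edges w" "c \<in> {1..r}" "x = grow_at p c w"
proof -
  have "\<exists>p c. p \<le> 2 * num_edges w \<and> c \<in> {1..r} \<and> x = grow_at p c w"
    using assms(2)
  proof (induction w arbitrary: x)
    case Leaf
    then show ?case using \<open>r \<ge> 1\<close> by (auto simp: grow_at_0)
  next
    case (Branch e a b)
    from Branch.prems consider
        a' where "a' \<in> set_pmf (grow r a)" "x = add_branch e a' b"
      | b' where "b' \<in> set_pmf (grow r b)" "x = add_branch e a b'"
      by (auto simp: grow_add_branch split: if_splits)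
    then show ?case
    proof cases
      case 1
      then obtain p c where "p \<le> 2 * num_edges a" "c \<in> {1..r}" "a' = grow_at p c a"
        using Branch.IH(1) by blast
      then show ?thesis
        using 1 by (intro exI[of _ "Suc p"] exI[of _ c]) (simp add: grow_at_in_branch)
    next
      case 2
      then obtain p c where "p \<le> 2 * num_edges b" "c \<in> {1..r}" "b' = grow_at p c b"
        using Branch.IH(2) by blast
      then show ?thesis
        using 2 by (intro exI[of _ "Suc (Suc (2 * num_edges a + p))"] exI[of _ c])
          (simp add: grow_at_after_branch)
    qed
  qed
  then show thesis using that by blast
qed

lemma finite_set_grow: "r \<ge> 1 \<Longrightarrow> finite (set_pmf (grow r w))"
  by (induction w) (auto simp: grow_add_branch)

lemma num_edges_grow: "\<lbrakk>r \<ge> 1; x \<in> set_pmf (grow r w)\<rbrakk> \<Longrightarrow> num_edges x = Suc (num_edges w)"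
  by (erule grow_is_grow_at, assumption) (simp add: num_edges_grow_at)

lemma grow_mem_coloured_trees:
  "\<lbrakk>r \<ge> 1; w \<in> coloured_trees r n; x \<in> set_pmf (grow r w)\<rbrakk> \<Longrightarrow> x \<in> coloured_trees r (Suc n)"
  by (erule grow_is_grow_at, assumption)
    (auto simp: mem_coloured_trees num_edges_grow_at colours_grow_at)

lemma pmf_map_add_branch_left:
  "pmf (map_pmf (\<lambda>a'. add_branch e a' b) M) (add_branch e' a' b') = (if e = e' \<and> b = b' then pmf M a' else 0)"
proof (cases "e = e' \<and> b = b'")
  case True
  then show ?thesis
    using pmf_map_inj'[of "\<lambda>a. add_branch e a b" M a'] by (simp add: inj_def)
qed (auto intro!: pmf_map_outside)

lemma pmf_map_add_branch_right:
  "pmf (map_pmf (add_branch e a) M) (add_branch e' a' b') = (if e = e' \<and> a = a' then pmf M b' else 0)"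
proof (cases "e = e' \<and> a = a'")
  case True
  then show ?thesis
    using pmf_map_inj'[of "add_branch e a" M b'] by (simp add: inj_def)
qed (auto intro!: pmf_map_outside)

lemma pmf_grow_add_branch:
  "pmf (grow r (add_branch e' a' b')) (add_branch e a b) =
     (if e' = e \<and> b' = b then left_prob (num_edges a') (num_edges b) * pmf (grow r a') a else 0) +
     (if e' = e \<and> a' = a then left_prob (num_edges b') (num_edges a) * pmf (grow r b') b else 0)"
proof -
  have "pmf (grow r (add_branch e' a' b')) (add_branch e a b) =
     (if e' = e \<and> b' = b then left_prob (num_edges a') (num_edges b') * pmf (grow r a') a else 0) +
     (if e' = e \<and> a' = a then left_prob (num_edges b') (num_edges a') * pmf (grow r b') b else 0)"
    by (simp add: grow_add_branch pmf_bind left_prob_bounds pmf_map_add_branch_left pmf_map_add_branch_right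
      left_prob_complement[symmetric])
  then show ?thesis by simp
qed

lemma pmf_grow_eq_0: "\<lbrakk>r \<ge> 1; num_edges x \<noteq> Suc (num_edges w)\<rbrakk> \<Longrightarrow> pmf (grow r w) x = 0"
  using num_edges_grow by (auto simp: set_pmf_iff)

lemma sum_eq_sum_on_image:
  fixes g :: "'b \<Rightarrow> real"
  assumes "finite T" "inj_on h A" "h ` A \<subseteq> T" "\<And>w. w \<in> T - h ` A \<Longrightarrow> G w = 0"
    "\<And>a. a \<in> A \<Longrightarrow> G (h a) = g a"
  shows "sum G T = sum g A"
proof -
  have "sum G T = sum G (h ` A)"
    using assms by (intro sum.mono_neutral_right) auto
  also have "\<dots> = sum (G \<circ> h) A"
    using assms by (simp add: sum.reindex)
  also have "\<dots> = sum g A"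
    using assms by (intro sum.cong) auto
  finally show ?thesis .
qed

lemma growth_ratio_pos: "growth_ratio m > 0"
  by (simp add: growth_ratio_def add_pos_nonneg)

definition prune_prob :: "nat \<Rightarrow> nat \<Rightarrow> real" where
  "prune_prob i j = real i * (real i + 1) * (real i + 3 * real j + 2) /
     ((real i + real j) * (real i + real j + 1) * (real i + real j + 2))"

lemma prune_prob_0 [simp]: "prune_prob 0 j = 0"
  by (simp add: prune_prob_def)

lemma prune_prob_complement:
  assumes "i + j > 0"
  shows "prune_prob i j + prune_prob j i = 1"
proof -
  define x y where "x = real i" and "y = real j"
  have "x + y > 0" using assms unfolding x_def y_def of_nat_add[symmetric] by (simp del: of_nat_add)
  then have "(x + y) * (x + y + 1) * (x + y + 2) \<noteq> 0"
    by simp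
  moreover have "x * (x + 1) * (x + 3 * y + 2) + y * (y + 1) * (y + 3 * x + 2)
      = (x + y) * (x + y + 1) * (x + y + 2)"
    by algebra
  ultimately show ?thesis
    unfolding prune_prob_def x_def[symmetric] y_def[symmetric]
    by (simp add: add.commute[of y x] add_divide_distrib[symmetric])
qed

lemma left_prob_eq_prune_prob:
  "left_prob i j / growth_ratio i = prune_prob (Suc i) j / growth_ratio (Suc i + j)"
proof -
  define x y where "x = real i" and "y = real j"
  have nn: "0 \<le> x" "0 \<le> y" by (simp_all add: x_def y_def)
  have d: "x + y + 1 \<noteq> 0" "x + y + 2 \<noteq> 0" "x + y + 3 \<noteq> 0" "2 * x + 2 * y + 3 \<noteq> 0" "2 * x + 1 \<noteq> 0"
     "x + 2 \<noteq> 0"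
     using nn by linarith+
  have x: "real (Suc i) = x + 1" "real (Suc i + j) = x + y + 1" by (simp_all add: x_def y_def)
  have "left_prob i j / growth_ratio i = (x + 1) * (x + 2) * (x + 3 * y + 3) /
     (2 * ((x + y + 1) * (x + y + 2) * (2 * x + 2 * y + 3)))"
  proof -
    have c: "growth_ratio i = 2 * (2 * x + 1) / (x + 2)"
      by (simp add: growth_ratio_def x_def)
    show ?thesis
      unfolding left_prob_def x_def[symmetric] y_def[symmetric] c
      using d by (simp add: frac_eq_eq) (simp add: algebra_simps)
  qed
  moreover have "prune_prob (Suc i) j / growth_ratio (Suc i + j) = (x + 1) * (x + 2) * (x + 3 * y + 3) /
     (2 * ((x + y + 1) * (x + y + 2) * (2 * x + 2 * y + 3)))"
  proof -
    have c: "growth_ratio (Suc i + j) = 2 * (2 * x + 2 * y + 3) / (x + y + 3)"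
      unfolding growth_ratio_def x by (simp add: algebra_simps)
    have p: "prune_prob (Suc i) j = (x + 1) * (x + 2) * (x + 3 * y + 3) /
        ((x + y + 1) * (x + y + 2) * (x + y + 3))"
      unfolding prune_prob_def x y_def[symmetric] by (simp add: algebra_simps)
    show ?thesis
      unfolding p c using d by (simp add: frac_eq_eq)
  qed
  ultimately show ?thesis by simp
qed

text \<open>
  The total probability of growing into \<open>x\<close> is the same for all \<open>x\<close>, which is what preserves uniformity. A tree
  \<open>a \<cdot> b\<close> arises by growth inside \<open>a\<close> or inside \<open>b\<close>; by induction these contribute
  \<open>prune_prob i j\<close> and \<open>prune_prob j i\<close> times the common value, and the two probabilities add up to one.
\<close>

lemma sum_pmf_grow:
  assumes "r \<ge> 1" and "x \<in> coloured_trees r (Suc m)"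
  shows "(\<Sum>w\<in>coloured_trees r m. pmf (grow r w) x) = 1 / (real r * growth_ratio m)"
  using assms(2)
proof (induction x arbitrary: m)
  case Leaf
  then show ?case by (simp add: mem_coloured_trees)
next
  case (Branch e a b)
  let ?i = "num_edges a" and ?j = "num_edges b"
  have m: "m = ?i + ?j" and e: "e \<in> {1..r}" and a: "a \<in> coloured_trees r ?i"
    and b: "b \<in> coloured_trees r ?j"
    using Branch.prems by (auto simp: mem_coloured_trees)
  \<comment> \<open>A sum over a set with at most one element: the term for growth inside the first branch if \<open>w\<close> has the right shape, else 0.\<close>
  define G1 where "G1 w = (\<Sum>a'\<in>{a'. w = add_branch e a' b}. left_prob (num_edges a') ?j * pmf (grow r a') a)" for w
  define G2 where "G2 w = (\<Sum>b'\<in>{b'. w = add_branch e a b'}. left_prob (num_edges b') ?i * pmf (grow r b') b)" for w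
  show ?case
  proof (cases "m = 0")
    case True
    then have "a = Node []" "b = Node []" using m by auto
    moreover have "pmf (map_pmf (\<lambda>c. add_branch c (Node []) (Node [])) (pmf_of_set {1..r})) (add_branch e (Node []) (Node []))
        = 1 / r"
      using pmf_map_inj'[of "\<lambda>c. add_branch c (Node []) (Node [])" "pmf_of_set {1..r}" e] e
      by (simp add: inj_def)
    ultimately show ?thesis
      using True by (simp add: growth_ratio_def)
  next
    case False
    have G1_add_branch: "G1 (add_branch e' a' b') = (if e' = e \<and> b' = b then left_prob (num_edges a') ?j * pmf (grow r a') a else 0)" for e' a' b'
    proof -
      have "{a''. add_branch e' a' b' = add_branch e a'' b} = (if e' = e \<and> b' = b then {a'} else {})"
        by auto
      then show ?thesis by (simp add: G1_def)
    qed
    have G2_add_branch: "G2 (add_branch e' a' b') = (if e' = e \<and> a' = a then left_prob (num_edges b') ?i * pmf (grow r b') b else 0)" for e' a' b'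
    proof -
      have "{b''. add_branch e' a' b' = add_branch e a b''} = (if e' = e \<and> a' = a then {b'} else {})"
        by auto
      then show ?thesis by (simp add: G2_def)
    qed
    have "(\<Sum>w\<in>coloured_trees r m. pmf (grow r w) (add_branch e a b)) = (\<Sum>w\<in>coloured_trees r m. G1 w + G2 w)"
    proof (intro sum.cong refl)
      fix w assume w: "w \<in> coloured_trees r m"
      with False obtain e' a' b' where "w = add_branch e' a' b'"
        by (cases w) (auto simp: mem_coloured_trees)
      then show "pmf (grow r w) (add_branch e a b) = G1 w + G2 w"
        by (simp add: G1_add_branch G2_add_branch pmf_grow_add_branch)
    qed
    also have "\<dots> = sum G1 (coloured_trees r m) + sum G2 (coloured_trees r m)"
      by (rule sum.distrib)
    also have "sum G1 (coloured_trees r m) = (if ?i = 0 then 0 else left_prob (?i - 1) ?j / (r * growth_ratio (?i - 1)))"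
    proof (cases "?i = 0")
      case True
      have "G1 w = 0" for w
        unfolding G1_def using pmf_grow_eq_0[OF assms(1), of a] True
        by (intro sum.neutral ballI) auto
      then show ?thesis using True by simp
    next
      case False
      then have pred: "Suc (num_edges a - Suc 0) = num_edges a" by (simp del: num_edges_eq_0)
      let ?A = "coloured_trees r (?i - 1)"
      have "sum G1 (coloured_trees r m) = (\<Sum>a'\<in>?A. left_prob (?i - 1) ?j * pmf (grow r a') a)"
      proof (rule sum_eq_sum_on_image[where h = "\<lambda>a'. add_branch e a' b"])
        fix w assume w: "w \<in> coloured_trees r m - (\<lambda>a'. add_branch e a' b) ` ?A"
        have "{a'. w = add_branch e a' b} = {}"
          using w m False b by (auto simp: mem_coloured_trees image_iff)
        then show "G1 w = 0" by (simp add: G1_def)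
      qed (use False m e b in \<open>auto simp: pred inj_on_def G1_add_branch mem_coloured_trees\<close>)
      then show ?thesis
        using False Branch.IH(1)[of "?i - 1"] a by (simp add: pred sum_distrib_left[symmetric])
    qed
    also have "sum G2 (coloured_trees r m) = (if ?j = 0 then 0 else left_prob (?j - 1) ?i / (r * growth_ratio (?j - 1)))"
    proof (cases "?j = 0")
      case True
      have "G2 w = 0" for w
        unfolding G2_def using pmf_grow_eq_0[OF assms(1), of b] True
        by (intro sum.neutral ballI) auto
      then show ?thesis using True by simp
    next
      case False
      then have pred: "Suc (num_edges b - Suc 0) = num_edges b" by (simp del: num_edges_eq_0)
      let ?B = "coloured_trees r (?j - 1)"
      have "sum G2 (coloured_trees r m) = (\<Sum>b'\<in>?B. left_prob (?j - 1) ?i * pmf (grow r b') b)"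
      proof (rule sum_eq_sum_on_image[where h = "add_branch e a"])
        fix w assume w: "w \<in> coloured_trees r m - add_branch e a ` ?B"
        have "{b'. w = add_branch e a b'} = {}"
          using w m False a by (auto simp: mem_coloured_trees image_iff)
        then show "G2 w = 0" by (simp add: G2_def)
      qed (use False m e a in \<open>auto simp: pred inj_on_def G2_add_branch mem_coloured_trees\<close>)
      then show ?thesis
        using False Branch.IH(2)[of "?j - 1"] b by (simp add: pred sum_distrib_left[symmetric])
    qed
    also have "(if ?i = 0 then 0 else left_prob (?i - 1) ?j / (r * growth_ratio (?i - 1))) +
        (if ?j = 0 then 0 else left_prob (?j - 1) ?i / (r * growth_ratio (?j - 1))) =
        1 / (r * growth_ratio m)"
    proof -
      have scale: "(if i = 0 then 0 else left_prob (i - 1) j / (r * growth_ratio (i - 1))) =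
          prune_prob i j / (r * growth_ratio (i + j))" for i j
      proof (cases i)
        case (Suc i')
        have "left_prob i' j / (r * growth_ratio i') = left_prob i' j / growth_ratio i' / r"
          by simp
        also have "\<dots> = prune_prob i j / (r * growth_ratio (i + j))"
          unfolding left_prob_eq_prune_prob Suc by simp
        finally show ?thesis by (simp add: Suc)
      qed simp
      show ?thesis
        using prune_prob_complement[of ?i ?j] False m
        unfolding scale add.commute[of ?j ?i] add_divide_distrib[symmetric]
        by (simp del: num_edges_eq_0)
    qed
    finally show ?thesis .
  qed
qed


text \<open>
  Counting comes for free: the growth probabilities out of each tree add up to one, and those
  into each tree add up to a known constant.
\<close>

lemma card_coloured_trees_Suc:
  assumes "r \<ge> 1"
  shows "real (card (coloured_trees r (Suc m))) = r * growth_ratio m * card (coloured_trees r m)"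
proof -
  have "real (card (coloured_trees r m)) =
      (\<Sum>w\<in>coloured_trees r m. \<Sum>x\<in>coloured_trees r (Suc m). pmf (grow r w) x)"
    using assms by (simp add: sum_pmf_eq_1 subsetI grow_mem_coloured_trees)
  also have "\<dots> = (\<Sum>x\<in>coloured_trees r (Suc m). \<Sum>w\<in>coloured_trees r m. pmf (grow r w) x)"
    by (rule sum.swap)
  also have "\<dots> = card (coloured_trees r (Suc m)) / (r * growth_ratio m)"
    using assms by (simp add: sum_pmf_grow)
  finally show ?thesis
    using assms growth_ratio_pos[of m] by (simp add: field_simps)
qed

lemma card_coloured_trees_pos: "r \<ge> 1 \<Longrightarrow> card (coloured_trees r n) > 0"
  by (simp add: card_gt_0_iff coloured_trees_nonempty)

lemma bind_grow_uniform:
  assumes "r \<ge> 1"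
  shows "bind_pmf (pmf_of_set (coloured_trees r m)) (grow r) = pmf_of_set (coloured_trees r (Suc m))"
proof (rule pmf_eqI)
  fix x
  note ne = coloured_trees_nonempty[OF assms]
  have "pmf (bind_pmf (pmf_of_set (coloured_trees r m)) (grow r)) x =
      (\<Sum>w\<in>coloured_trees r m. pmf (grow r w) x) / card (coloured_trees r m)"
    by (simp add: pmf_bind_pmf_of_set ne)
  also have "\<dots> = pmf (pmf_of_set (coloured_trees r (Suc m))) x"
  proof (cases "x \<in> coloured_trees r (Suc m)")
    case True
    then show ?thesis
      using assms by (simp add: sum_pmf_grow ne card_coloured_trees_Suc)
  next
    case False
    then have "pmf (grow r w) x = 0" if "w \<in> coloured_trees r m" for w
      using grow_mem_coloured_trees[OF assms that] by (auto simp: set_pmf_iff)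
    then show ?thesis
      using False by (simp add: ne)
  qed
  finally show "pmf (bind_pmf (pmf_of_set (coloured_trees r m)) (grow r)) x =
      pmf (pmf_of_set (coloured_trees r (Suc m))) x" .
qed

text \<open>
  A history \<open>h\<close> records the whole growth of a tree: \<open>h k\<close> is the tree at the time when it has \<open>k\<close> edges.
  Beyond the final time it stays at its
  initial value.
\<close>

fun growth_history :: "nat \<Rightarrow> nat \<Rightarrow> (nat \<Rightarrow> ctree) pmf" where
  "growth_history r 0 = return_pmf (\<lambda>_. Node [])"
| "growth_history r (Suc m) =
     bind_pmf (growth_history r m) (\<lambda>h. map_pmf (\<lambda>x. h(Suc m := x)) (grow r (h m)))"

lemma finite_growth_history: "r \<ge> 1 \<Longrightarrow> finite (set_pmf (growth_history r m))"
  by (induction m) (simp_all add: finite_set_grow)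

lemma growth_history_marginal:
  assumes "r \<ge> 1" "k \<le> m"
  shows "map_pmf (\<lambda>h. h k) (growth_history r m) = pmf_of_set (coloured_trees r k)"
  using assms(2)
proof (induction m arbitrary: k)
  case 0
  then show ?case by (simp add: pmf_of_set_singleton)
next
  case (Suc m)
  show ?case
  proof (cases "k = Suc m")
    case True
    have "map_pmf (\<lambda>h. h k) (growth_history r (Suc m)) =
        bind_pmf (map_pmf (\<lambda>h. h m) (growth_history r m)) (grow r)"
      using True by (simp add: map_bind_pmf bind_map_pmf pmf.map_comp comp_def)
    then show ?thesis
      using True Suc.IH[of m] bind_grow_uniform[OF assms(1)] by simp
  next
    case False
    then have "map_pmf (\<lambda>h. h k) (growth_history r (Suc m)) = map_pmf (\<lambda>h. h k) (growth_history r m)"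
      by (simp add: map_bind_pmf pmf.map_comp comp_def map_pmf_def[symmetric])
    then show ?thesis
      using False Suc by simp
  qed
qed

lemma growth_history_mem:
  assumes "r \<ge> 1" "h \<in> set_pmf (growth_history r m)" "k \<le> m"
  shows "h k \<in> coloured_trees r k"
proof -
  have "h k \<in> set_pmf (map_pmf (\<lambda>h. h k) (growth_history r m))"
    using assms(2) by simp
  then show ?thesis
    using assms by (simp add: growth_history_marginal coloured_trees_nonempty)
qed

lemma growth_history_step:
  assumes "h \<in> set_pmf (growth_history r m)" "k < m"
  shows "h (Suc k) \<in> set_pmf (grow r (h k))"
  using assms
proof (induction m arbitrary: h)
  case (Suc m)
  then show ?case by (auto simp: less_Suc_eq)
qed simp

lemma expectation_growth_history:
  fixes F :: "ctree \<Rightarrow> real"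
  assumes "r \<ge> 1" "k \<le> m"
  shows "measure_pmf.expectation (growth_history r m) (\<lambda>h. F (h k)) =
    sum F (coloured_trees r k) / card (coloured_trees r k)"
proof -
  have "measure_pmf.expectation (growth_history r m) (\<lambda>h. F (h k)) =
      measure_pmf.expectation (map_pmf (\<lambda>h. h k) (growth_history r m)) F"
    by simp
  then show ?thesis
    using assms by (simp only: growth_history_marginal integral_pmf_of_set coloured_trees_nonempty
        finite_coloured_trees not_False_eq_True)
qed

section \<open>Moving one leaf\<close>

text \<open>
  The tree \<open>w\<close> lacks the leaf that moves. Fixing it, and letting the leaf pass through all its places and
  colours, lists the moves that the paths below use around \<open>w\<close>.
\<close>

definition leaf_energy :: "nat \<Rightarrow> (ctree \<Rightarrow> real) \<Rightarrow> ctree \<Rightarrow> real" where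
  "leaf_energy r f w =
     (\<Sum>p<2 * num_edges w. \<Sum>c\<in>{1..r}. (f (grow_at p c w) - f (grow_at (Suc p) c w))\<^sup>2) +
     (\<Sum>p\<le>2 * num_edges w. \<Sum>c\<in>{1..r}. \<Sum>c'\<in>{1..r}. (f (grow_at p c w) - f (grow_at p c' w))\<^sup>2)"

lemma leaf_energy_nonneg: "0 \<le> leaf_energy r f w"
  by (simp add: leaf_energy_def sum_nonneg)

lemma square_diff_le_sum_of_steps:
  fixes g :: "nat \<Rightarrow> real"
  assumes "p \<le> M" "q \<le> M"
  shows "(g p - g q)\<^sup>2 \<le> M * (\<Sum>i<M. (g i - g (Suc i))\<^sup>2)"
proof -
  have *: "(g p - g q)\<^sup>2 \<le> M * (\<Sum>i<M. (g i - g (Suc i))\<^sup>2)" if "p \<le> q" "q \<le> M" for p q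
  proof -
    have "g p - g q = (\<Sum>i=p..<q. g i - g (Suc i))"
      using that(1) by (induction q rule: dec_induct) simp_all
    then have "(g p - g q)\<^sup>2 \<le> (\<Sum>i=p..<q. (g i - g (Suc i))\<^sup>2) * real (q - p)"
      using sum_squared_le_sum_of_squares[of "\<lambda>i. g i - g (Suc i)" "{p..<q}"] by simp
    also have "\<dots> \<le> (\<Sum>i<M. (g i - g (Suc i))\<^sup>2) * real M"
      using that by (intro mult_mono sum_mono2 sum_nonneg) auto
    finally show ?thesis by (simp add: mult.commute)
  qed
  show ?thesis
    using *[of p q] *[of q p] assms by (cases "p \<le> q") (simp_all add: power2_commute)
qed

text \<open>
  The leaf travels through at most \<open>2 m\<close> places in its old colour and is then recoloured once.
\<close>

lemma square_diff_le_leaf_energy: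
  assumes "num_edges w = m" "p \<le> 2 * m" "q \<le> 2 * m" "c \<in> {1..r}" "c' \<in> {1..r}"
  shows "(f (grow_at p c w) - f (grow_at q c' w))\<^sup>2 \<le> 4 * (real m + 1) * leaf_energy r f w"
proof -
  let ?g = "\<lambda>p c. f (grow_at p c w)"
  define T R where
    "T = (\<Sum>p<2 * m. \<Sum>c\<in>{1..r}. (?g p c - ?g (Suc p) c)\<^sup>2)" and
    "R = (\<Sum>p\<le>2 * m. \<Sum>c\<in>{1..r}. \<Sum>c'\<in>{1..r}. (?g p c - ?g p c')\<^sup>2)"
  have nonneg: "0 \<le> T" "0 \<le> R"
    by (simp_all add: T_def R_def sum_nonneg)
  have "(?g p c - ?g q c)\<^sup>2 \<le> (2 * m) * (\<Sum>i<2 * m. (?g i c - ?g (Suc i) c)\<^sup>2)"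
    using square_diff_le_sum_of_steps[of p "2 * m" q "\<lambda>p. ?g p c"] assms by simp
  also have "\<dots> \<le> (2 * m) * T"
    unfolding T_def
  proof (intro mult_left_mono sum_mono)
    fix i
    show "(?g i c - ?g (Suc i) c)\<^sup>2 \<le> (\<Sum>c\<in>{1..r}. (?g i c - ?g (Suc i) c)\<^sup>2)"
      using assms by (intro member_le_sum) auto
  qed simp
  finally have trans: "(?g p c - ?g q c)\<^sup>2 \<le> (2 * m) * T" .
  have "(?g q c - ?g q c')\<^sup>2 \<le> (\<Sum>c'\<in>{1..r}. (?g q c - ?g q c')\<^sup>2)"
    using assms by (intro member_le_sum) auto
  also have "\<dots> \<le> (\<Sum>c\<in>{1..r}. \<Sum>c'\<in>{1..r}. (?g q c - ?g q c')\<^sup>2)"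
    using assms by (intro member_le_sum[of c]) (auto intro: sum_nonneg)
  also have "\<dots> \<le> R"
    unfolding R_def using assms by (intro member_le_sum[of q]) (auto intro!: sum_nonneg)
  finally have rec: "(?g q c - ?g q c')\<^sup>2 \<le> R" .
  have "(?g p c - ?g q c')\<^sup>2 \<le> 2 * (?g p c - ?g q c)\<^sup>2 + 2 * (?g q c - ?g q c')\<^sup>2"
    using sum_squares_bound[of "?g p c - ?g q c" "?g q c - ?g q c'"]
    by (simp add: power2_eq_square algebra_simps)
  also have "\<dots> \<le> 2 * ((2 * m) * T) + 2 * R"
    using trans rec by linarith
  also have "\<dots> \<le> 4 * (real m + 1) * (T + R)"
    using nonneg mult_nonneg_nonneg[of "real m" R] by (simp add: algebra_simps)
  finally show ?thesis
    using assms(1) by (simp add: leaf_energy_def T_def R_def)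
qed

section \<open>Comparison with the Dirichlet form of the chain\<close>

lemma finite_card_moves: "finite (moves r)" "card (moves r) = r + 2"
proof -
  show "finite (moves r)" by (simp add: moves_def)
  have "card (Recolour ` {1..r}) = r"
    by (simp add: card_image inj_on_def)
  moreover have "moves r = insert Translate_Right (insert Translate_Left (Recolour ` {1..r}))"
    by (auto simp: moves_def)
  ultimately show "card (moves r) = r + 2"
    by (auto simp: card_insert_if)
qed

text \<open>
  Moves leading out of \<open>\<Omega>\<close> count for nothing, because the Dirichlet form sums over \<open>\<Omega>\<close> only.
\<close>

definition move_energy :: "nat \<Rightarrow> ctree set \<Rightarrow> (ctree \<Rightarrow> real) \<Rightarrow> ctree \<Rightarrow> vertex \<Rightarrow> real" where
  "move_energy r \<Omega> f x v =
     (\<Sum>\<mu>\<in>moves r. if apply_move \<mu> x v \<in> \<Omega> then (f x - f (apply_move \<mu> x v))\<^sup>2 else 0)"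

lemma move_energy_nonneg: "0 \<le> move_energy r \<Omega> f x v"
  by (simp add: move_energy_def sum_nonneg)

text \<open>
  Each elementary move of a leaf added to \<open>w\<close> is a right translation or a recolouring of a leaf of the grown tree.
  No move is counted twice, since erasing the leaf recovers \<open>w\<close>, and the position and colour of the leaf
  recover the other data. The remaining moves only contribute nonnegative terms.
\<close>

lemma sum_leaf_energy_le:
  "(\<Sum>w\<in>coloured_trees r m. leaf_energy r f w) \<le>
   (\<Sum>x\<in>coloured_trees r (Suc m). \<Sum>v\<in>{v \<in> edges x. is_leaf x v}.
      move_energy r (coloured_trees r (Suc m)) f x v)"
proof -
  let ?\<Omega> = "coloured_trees r (Suc m)"
  let ?I = "coloured_trees r m \<times> {..2 * m} \<times> {1..r}"
  let ?\<phi> = "\<lambda>(w, p, c). (grow_at p c w, new_vertex p w)"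
  let ?J = "SIGMA x:?\<Omega>. {v \<in> edges x. is_leaf x v}"
  define D where "D = (\<lambda>(w, p, c).
    (if p < 2 * m then (f (grow_at p c w) - f (grow_at (Suc p) c w))\<^sup>2 else 0) +
    (\<Sum>c'\<in>{1..r}. (f (grow_at p c w) - f (grow_at p c' w))\<^sup>2))"
  have energy: "leaf_energy r f w = (\<Sum>p\<le>2 * m. \<Sum>c\<in>{1..r}. D (w, p, c))"
    if "w \<in> coloured_trees r m" for w
  proof -
    have "(\<Sum>p<2 * m. \<Sum>c\<in>{1..r}. (f (grow_at p c w) - f (grow_at (Suc p) c w))\<^sup>2) =
        (\<Sum>p\<le>2 * m. \<Sum>c\<in>{1..r}. if p < 2 * m then (f (grow_at p c w) - f (grow_at (Suc p) c w))\<^sup>2 else 0)"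
      by (intro sum.mono_neutral_cong_left) auto
    then show ?thesis
      using that by (simp add: leaf_energy_def D_def sum.distrib mem_coloured_trees)
  qed
  have "(\<Sum>w\<in>coloured_trees r m. leaf_energy r f w) = sum D ?I"
    by (simp add: energy sum.cartesian_product case_prod_beta)
  also have "\<dots> \<le> (\<Sum>i\<in>?I. case ?\<phi> i of (x, v) \<Rightarrow> move_energy r ?\<Omega> f x v)"
  proof (rule sum_mono)
    fix i assume "i \<in> ?I"
    then obtain w p c where i: "i = (w, p, c)" and w: "w \<in> coloured_trees r m"
      and p: "p \<le> 2 * m" and c: "c \<in> {1..r}"
      by auto
    have s: "num_edges w = m" using w by (simp add: mem_coloured_trees)
    let ?x = "grow_at p c w" and ?v = "new_vertex p w"
    let ?e = "\<lambda>\<mu>. if apply_move \<mu> ?x ?v \<in> ?\<Omega> then (f ?x - f (apply_move \<mu> ?x ?v))\<^sup>2 else 0"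
    have recolour: "?e (Recolour c') = (f ?x - f (grow_at p c' w))\<^sup>2" if "c' \<in> {1..r}" for c'
      using w p that s by (simp add: recolour_new_vertex grow_at_mem_coloured_trees)
    have right: "?e Translate_Right \<ge> (if p < 2 * m then (f ?x - f (grow_at (Suc p) c w))\<^sup>2 else 0)"
      using w c s by (simp add: translate_right_new_vertex grow_at_mem_coloured_trees)
    have "D i \<le> ?e Translate_Right + (\<Sum>c'\<in>{1..r}. ?e (Recolour c'))"
      unfolding i D_def prod.case using right
      by (intro add_mono) (auto simp only: recolour intro!: sum_mono)
    also have "\<dots> = sum ?e (insert Translate_Right (Recolour ` {1..r}))"
      by (subst sum.insert) (auto simp: sum.reindex inj_on_def)
    also have "\<dots> \<le> sum ?e (moves r)"
      by (intro sum_mono2) (auto simp: moves_def)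
    finally show "D i \<le> (case ?\<phi> i of (x, v) \<Rightarrow> move_energy r ?\<Omega> f x v)"
      by (simp add: i move_energy_def)
  qed
  also have "\<dots> = (\<Sum>(x, v)\<in>?\<phi> ` ?I. move_energy r ?\<Omega> f x v)"
  proof (subst sum.reindex)
    show "inj_on ?\<phi> ?I"
    proof (rule inj_onI)
      fix i j assume "i \<in> ?I" "j \<in> ?I" and eq: "?\<phi> i = ?\<phi> j"
      then obtain w p c w' p' c' where ij: "i = (w, p, c)" "j = (w', p', c')"
        and p: "p \<le> 2 * num_edges w" and p': "p' \<le> 2 * num_edges w'"
        by (auto simp: mem_coloured_trees)
      have eqs: "grow_at p c w = grow_at p' c' w'" "new_vertex p w = new_vertex p' w'"
        using eq ij by auto
      have "w = w'"
        using erase_new_vertex[OF p, of c] erase_new_vertex[OF p', of c'] eqs by simp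
      moreover have "p = p'"
        using leaf_position_new_vertex[OF p, of c] leaf_position_new_vertex[OF p', of c'] eqs by simp
      moreover have "c = c'"
        using colour_new_vertex[OF p, of c] colour_new_vertex[OF p', of c'] eqs by simp
      ultimately show "i = j" by (simp add: ij)
    qed
  qed (simp add: comp_def)
  also have "\<dots> \<le> (\<Sum>(x, v)\<in>?J. move_energy r ?\<Omega> f x v)"
  proof (rule sum_mono2)
    show "finite ?J" by simp
    show "?\<phi> ` ?I \<subseteq> ?J"
    proof
      fix y assume "y \<in> ?\<phi> ` ?I"
      then obtain w p c where y: "y = (grow_at p c w, new_vertex p w)"
        and A: "w \<in> coloured_trees r m" "p \<in> {..2 * m}" "c \<in> {1..r}"
        by auto
      have leaf: "is_leaf (grow_at p c w) (new_vertex p w)"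
        using A by (intro is_leaf_new_vertex) (simp add: mem_coloured_trees)
      have "new_vertex p w \<in> edges (grow_at p c w)"
        using leaf unfolding is_leaf_def edges_def by blast
      moreover have "grow_at p c w \<in> ?\<Omega>"
        using A by (intro grow_at_mem_coloured_trees) auto
      ultimately show "y \<in> ?J"
        using leaf by (simp only: y mem_Sigma_iff mem_Collect_eq)
    qed
  qed (auto simp: move_energy_nonneg)
  also have "\<dots> = (\<Sum>x\<in>?\<Omega>. \<Sum>v\<in>{v \<in> edges x. is_leaf x v}. move_energy r ?\<Omega> f x v)"
    by (simp add: sum.Sigma)
  finally show ?thesis .
qed

lemma leaf_translation_chain_energy:
  assumes "finite \<Omega>" "edges x \<noteq> {}"
  shows "(\<Sum>v\<in>{v \<in> edges x. is_leaf x v}. move_energy r \<Omega> f x v) / (num_edges x * (r + 2)) \<le>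
    (\<Sum>y\<in>\<Omega>. (f x - f y)\<^sup>2 * pmf (leaf_translation_chain r x) y)"
proof -
  let ?K = "\<lambda>v. if is_leaf x v then map_pmf (\<lambda>\<mu>. apply_move \<mu> x v) (pmf_of_set (moves r)) else return_pmf x"
  have move: "(\<Sum>y\<in>\<Omega>. (f x - f y)\<^sup>2 * pmf (?K v) y) = move_energy r \<Omega> f x v / (r + 2)"
    if "is_leaf x v" for v
  proof -
    let ?F = "\<lambda>y. if y \<in> \<Omega> then (f x - f y)\<^sup>2 else 0"
    have "(\<Sum>y\<in>\<Omega>. (f x - f y)\<^sup>2 * pmf (?K v) y) = (\<Sum>y\<in>\<Omega>. ?F y * pmf (?K v) y)"
      by simp
    also have "\<dots> = measure_pmf.expectation (?K v) ?F"
      by (rule integral_measure_pmf_real[symmetric]) (use assms in \<open>auto split: if_splits\<close>)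
    also have "\<dots> = measure_pmf.expectation (pmf_of_set (moves r)) (\<lambda>\<mu>. ?F (apply_move \<mu> x v))"
      using that by simp
    also have "\<dots> = move_energy r \<Omega> f x v / (r + 2)"
      by (subst integral_pmf_of_set) (simp_all add: finite_card_moves move_energy_def, simp add: moves_def)
    finally show ?thesis .
  qed
  have "(\<Sum>v\<in>{v \<in> edges x. is_leaf x v}. move_energy r \<Omega> f x v) / (num_edges x * (r + 2)) =
      (\<Sum>v\<in>{v \<in> edges x. is_leaf x v}. \<Sum>y\<in>\<Omega>. (f x - f y)\<^sup>2 * pmf (?K v) y) / num_edges x"
    proof -
    have "(\<Sum>v\<in>{v \<in> edges x. is_leaf x v}. \<Sum>y\<in>\<Omega>. (f x - f y)\<^sup>2 * pmf (?K v) y) =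
        (\<Sum>v\<in>{v \<in> edges x. is_leaf x v}. move_energy r \<Omega> f x v / (r + 2))"
      by (rule sum.cong[OF refl], rule move) blast
    also have "\<dots> = (\<Sum>v\<in>{v \<in> edges x. is_leaf x v}. move_energy r \<Omega> f x v) / (r + 2)"
      by (rule sum_divide_distrib[symmetric])
    finally have *: "(\<Sum>v\<in>{v \<in> edges x. is_leaf x v}. \<Sum>y\<in>\<Omega>. (f x - f y)\<^sup>2 * pmf (?K v) y) =
        (\<Sum>v\<in>{v \<in> edges x. is_leaf x v}. move_energy r \<Omega> f x v) / (r + 2)" .
    show ?thesis
      unfolding * divide_divide_eq_left of_nat_mult mult.commute[of "real (num_edges x)"] ..
  qed
  also have "\<dots> \<le> (\<Sum>v\<in>edges x. \<Sum>y\<in>\<Omega>. (f x - f y)\<^sup>2 * pmf (?K v) y) / num_edges x"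
    by (intro divide_right_mono sum_mono2) (auto intro!: sum_nonneg)
  also have "\<dots> = (\<Sum>y\<in>\<Omega>. (f x - f y)\<^sup>2 * pmf (leaf_translation_chain r x) y)"
  proof -
    have pmf: "pmf (leaf_translation_chain r x) y = (\<Sum>v\<in>edges x. pmf (?K v) y) / num_edges x" for y
      unfolding leaf_translation_chain_def by (simp add: pmf_bind_pmf_of_set assms)
    show ?thesis
      unfolding pmf times_divide_eq_right sum_distrib_left sum_divide_distrib[symmetric]
      by (subst sum.swap) (rule refl)
  qed
  finally show ?thesis .
qed

lemma sum_leaf_energy_le_dirichlet_form:
  fixes r m :: nat
  assumes "r \<ge> 1"
  defines "\<Omega> \<equiv> coloured_trees r (Suc m)"
  shows "(\<Sum>w\<in>coloured_trees r m. leaf_energy r f w) \<le>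
    2 * card \<Omega> * Suc m * (r + 2) *
      dirichlet_form \<Omega> (pmf_of_set \<Omega>) (leaf_translation_chain r) f"
proof -
  let ?M = "\<lambda>x. \<Sum>v\<in>{v \<in> edges x. is_leaf x v}. move_energy r \<Omega> f x v"
  let ?K = "\<lambda>x. \<Sum>y\<in>\<Omega>. (f x - f y)\<^sup>2 * pmf (leaf_translation_chain r x) y"
  define a where "a = real (Suc m * (r + 2))"
  have "a > 0" by (simp add: a_def del: of_nat_Suc)
  have \<Omega>: "finite \<Omega>" "\<Omega> \<noteq> {}" "card \<Omega> > 0"
    using assms(1) card_coloured_trees_pos[of r "Suc m"] by (simp_all add: \<Omega>_def coloured_trees_nonempty)
  have "dirichlet_form \<Omega> (pmf_of_set \<Omega>) (leaf_translation_chain r) f =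
      1 / 2 * (\<Sum>x\<in>\<Omega>. ?K x / card \<Omega>)"
    unfolding dirichlet_form_def sum_divide_distrib using \<Omega>
    by (intro arg_cong2[where f="(*)"] sum.cong refl) simp
  then have K: "sum ?K \<Omega> = 2 * card \<Omega> * dirichlet_form \<Omega> (pmf_of_set \<Omega>) (leaf_translation_chain r) f"
    using \<Omega> by (simp add: sum_divide_distrib[symmetric])
  have "(\<Sum>w\<in>coloured_trees r m. leaf_energy r f w) \<le> sum ?M \<Omega>"
    unfolding \<Omega>_def by (rule sum_leaf_energy_le)
  also have "\<dots> \<le> (\<Sum>x\<in>\<Omega>. ?K x * a)"
  proof (rule sum_mono)
    fix x assume "x \<in> \<Omega>"
    then have x: "num_edges x = Suc m" by (simp add: \<Omega>_def mem_coloured_trees)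
    then have "edges x \<noteq> {}" using card_edges[of x] by force
    from leaf_translation_chain_energy[OF \<Omega>(1) this, of r f]
    have "?M x / a \<le> ?K x" by (simp only: x a_def)
    then show "?M x \<le> ?K x * a"
      using \<open>a > 0\<close> by (simp only: pos_divide_le_eq)
  qed
  also have "\<dots> = (2 * card \<Omega> * dirichlet_form \<Omega> (pmf_of_set \<Omega>) (leaf_translation_chain r) f) * a"
    unfolding sum_distrib_right[symmetric] K ..
  also have "\<dots> = real (2 * card \<Omega> * Suc m * (r + 2)) *
      dirichlet_form \<Omega> (pmf_of_set \<Omega>) (leaf_translation_chain r) f"
    unfolding a_def of_nat_mult of_nat_numeral by algebra
  finally show ?thesis .
qed

section \<open>Variance and expectation over finite sets\<close>

lemma variance_pmf_of_set:
  assumes "finite \<Omega>" "\<Omega> \<noteq> {}"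
  shows "measure_pmf.variance (pmf_of_set \<Omega>) f =
    (\<Sum>x\<in>\<Omega>. (f x - sum f \<Omega> / card \<Omega>)\<^sup>2) / card \<Omega>"
  using assms by (simp add: integral_pmf_of_set)

text \<open>
  The mean is the best constant approximation in mean square.
\<close>

lemma variance_pmf_of_set_le:
  fixes f :: "'a \<Rightarrow> real"
  assumes "finite \<Omega>" "\<Omega> \<noteq> {}"
  shows "measure_pmf.variance (pmf_of_set \<Omega>) f \<le> (\<Sum>x\<in>\<Omega>. (f x - c)\<^sup>2) / card \<Omega>"
proof -
  define \<mu> where "\<mu> = sum f \<Omega> / card \<Omega>"
  have pos: "card \<Omega> > 0" using assms by (simp add: card_gt_0_iff)
  have "(\<Sum>x\<in>\<Omega>. f x - \<mu>) = 0"
    using pos by (simp add: sum_subtractf \<mu>_def)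
  moreover have "(\<Sum>x\<in>\<Omega>. (f x - c)\<^sup>2) =
      (\<Sum>x\<in>\<Omega>. (f x - \<mu>)\<^sup>2 + 2 * (\<mu> - c) * (f x - \<mu>) + (\<mu> - c)\<^sup>2)"
    by (intro sum.cong) (auto simp: power2_eq_square algebra_simps)
  ultimately have "(\<Sum>x\<in>\<Omega>. (f x - c)\<^sup>2) = (\<Sum>x\<in>\<Omega>. (f x - \<mu>)\<^sup>2) + card \<Omega> * (\<mu> - c)\<^sup>2"
    by (simp add: sum.distrib sum_distrib_left[symmetric])
  then have "(\<Sum>x\<in>\<Omega>. (f x - \<mu>)\<^sup>2) \<le> (\<Sum>x\<in>\<Omega>. (f x - c)\<^sup>2)"
    by simp
  then show ?thesis
    unfolding variance_pmf_of_set[OF assms] \<mu>_def[symmetric]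
    by (intro divide_right_mono) auto
qed

lemma variance_pmf_of_set_pos:
  fixes f :: "'a \<Rightarrow> real"
  assumes "finite \<Omega>" "x \<in> \<Omega>" "y \<in> \<Omega>" "f x \<noteq> f y"
  shows "measure_pmf.variance (pmf_of_set \<Omega>) f > 0"
proof -
  define \<mu> where "\<mu> = sum f \<Omega> / card \<Omega>"
  have ne: "\<Omega> \<noteq> {}" using assms by auto
  obtain z where z: "z \<in> \<Omega>" "f z \<noteq> \<mu>"
    using assms by (cases "f x = \<mu>") auto
  have "(\<Sum>x\<in>\<Omega>. (f x - \<mu>)\<^sup>2) > 0"
    using z assms(1) by (intro sum_pos2[of _ z]) auto
  then show ?thesis
    unfolding variance_pmf_of_set[OF assms(1) ne] \<mu>_def[symmetric]
    using ne assms(1) by (simp add: card_gt_0_iff)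
qed

lemma pmf_expectation_mono:
  fixes F G :: "'a \<Rightarrow> real"
  assumes "finite (set_pmf M)" "\<And>x. x \<in> set_pmf M \<Longrightarrow> F x \<le> G x"
  shows "measure_pmf.expectation M F \<le> measure_pmf.expectation M G"
  using assms by (intro integral_mono_AE integrable_measure_pmf_finite) (auto simp: AE_measure_pmf_iff)

section \<open>Transporting one history into another\<close>

text \<open>
  Since \<open>add_branch 1 (Node []) w\<close> is \<open>w\<close> with a new leaf at its first place, both trees are \<open>w\<close> with one leaf
  added.
\<close>

lemma growth_step_energy:
  assumes "r \<ge> 1" "x \<in> set_pmf (grow r w)" "w \<in> coloured_trees r m"
  shows "(f x - f (add_branch 1 (Node []) w))\<^sup>2 \<le> 4 * (real m + 1) * leaf_energy r f w"
proof -
  obtain p c where "p \<le> 2 * num_edges w" "c \<in> {1..r}" "x = grow_at p c w"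
    using assms by (elim grow_is_grow_at)
  then show ?thesis
    using square_diff_le_leaf_energy[of w m p 0 c r 1 f] assms
    by (simp add: grow_at_0 mem_coloured_trees)
qed

text \<open>
  Removing the leaf by which \<open>x'\<close> exceeds \<open>x\<close>, or the one by which \<open>z'\<close> exceeds \<open>z\<close>, leaves
  \<open>add_branch 1 z x\<close> in both cases. So the two trees differ in the place and colour of one leaf.
\<close>

lemma transfer_step_energy:
  assumes "r \<ge> 1" "z' \<in> set_pmf (grow r z)" "x' \<in> set_pmf (grow r x)"
    and "num_edges z + num_edges x + 1 = m"
  shows "(f (add_branch 1 z x') - f (add_branch 1 z' x))\<^sup>2 \<le> 4 * (real m + 1) * leaf_energy r f (add_branch 1 z x)"
proof -
  obtain p c where p: "p \<le> 2 * num_edges x" "c \<in> {1..r}" "x' = grow_at p c x"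
    using assms by (elim grow_is_grow_at)
  obtain q c' where q: "q \<le> 2 * num_edges z" "c' \<in> {1..r}" "z' = grow_at q c' z"
    using assms by (elim grow_is_grow_at)
  show ?thesis
    using square_diff_le_leaf_energy[of "add_branch 1 z x" m "Suc (Suc (2 * num_edges z + p))" "Suc q" c r c' f]
      p q assms by (simp add: grow_at_in_branch grow_at_after_branch)
qed

text \<open>
  The path from the final tree of \<open>h\<close> to the final tree of \<open>g\<close> hung below the origin: run \<open>h\<close> backwards and \<open>g\<close>
  forwards, reusing each leaf that \<open>h\<close> gives up.
\<close>

lemma history_path_energy:
  assumes "r \<ge> 1" and h: "h \<in> set_pmf (growth_history r (Suc m))"
    and g: "g \<in> set_pmf (growth_history r m)"
  shows "(f (h (Suc m)) - f (add_branch 1 (g m) (Node [])))\<^sup>2 \<le>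
    4 * (real m + 1)\<^sup>2 * (leaf_energy r f (h m) +
      (\<Sum>k<m. leaf_energy r f (add_branch 1 (g k) (h (m - 1 - k)))))"
proof -
  define S where "S k = add_branch 1 (g k) (h (m - k))" for k
  define \<Delta> where "\<Delta> k = (case k of 0 \<Rightarrow> f (h (Suc m)) - f (S 0) | Suc k \<Rightarrow> f (S k) - f (S (Suc k)))" for k
  define W where "W k = (case k of 0 \<Rightarrow> leaf_energy r f (h m)
      | Suc k \<Rightarrow> leaf_energy r f (add_branch 1 (g k) (h (m - 1 - k))))" for k
  have h0: "h 0 = Node []" and g0: "g 0 = Node []"
    using growth_history_mem[OF assms(1) h, of 0] growth_history_mem[OF assms(1) g, of 0] by simp_all
  have step: "(\<Delta> k)\<^sup>2 \<le> 4 * (real m + 1) * W k" if "k < Suc m" for k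
  proof (cases k)
    case 0
    then show ?thesis
      using growth_step_energy[OF assms(1) growth_history_step[OF h, of m] growth_history_mem[OF assms(1) h, of m], of f]
      by (simp add: \<Delta>_def W_def S_def g0)
  next
    case (Suc i)
    then have i: "i < m" using that by simp
    have z: "g i \<in> coloured_trees r i" and x: "h (m - 1 - i) \<in> coloured_trees r (m - 1 - i)"
      using growth_history_mem[OF assms(1) g, of i] growth_history_mem[OF assms(1) h, of "m - 1 - i"] i
      by simp_all
    have z': "g (Suc i) \<in> set_pmf (grow r (g i))"
      using growth_history_step[OF g i] .
    have "Suc (m - 1 - i) = m - i" using i by simp
    then have x': "h (m - i) \<in> set_pmf (grow r (h (m - 1 - i)))"
      using growth_history_step[OF h, of "m - 1 - i"] i by simp
    have "num_edges (g i) + num_edges (h (m - 1 - i)) + 1 = m"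
      using z x i by (simp add: mem_coloured_trees)
    from transfer_step_energy[OF assms(1) z' x' this, of f] show ?thesis
      by (simp add: Suc \<Delta>_def W_def S_def)
  qed
  have "f (h (Suc m)) - f (add_branch 1 (g m) (Node [])) = (\<Sum>k<Suc m. \<Delta> k)"
  proof -
    have "(\<Sum>k<j. f (S k) - f (S (Suc k))) = f (S 0) - f (S j)" for j
      by (rule sum_lessThan_telescope')
    then show ?thesis
      unfolding sum.lessThan_Suc_shift by (simp add: \<Delta>_def) (simp add: S_def h0)
  qed
  then have "(f (h (Suc m)) - f (add_branch 1 (g m) (Node [])))\<^sup>2 \<le> (\<Sum>k<Suc m. (\<Delta> k)\<^sup>2) * (real m + 1)"
    using sum_squared_le_sum_of_squares[of \<Delta> "{..<Suc m}"] by (simp add: add.commute)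
  also have "\<dots> \<le> (\<Sum>k<Suc m. 4 * (real m + 1) * W k) * (real m + 1)"
    using step by (intro mult_right_mono sum_mono) auto
  also have "\<dots> = 4 * (real m + 1)\<^sup>2 * (\<Sum>k<Suc m. W k)"
    by (simp add: sum_distrib_left[symmetric] power2_eq_square del: sum.lessThan_Suc)
  also have "(\<Sum>k<Suc m. W k) = leaf_energy r f (h m) +
      (\<Sum>k<m. leaf_energy r f (add_branch 1 (g k) (h (m - 1 - k))))"
    unfolding sum.lessThan_Suc_shift by (simp add: W_def)
  finally show ?thesis .
qed

text \<open>
  The sizes of the two parts can be read off from the composed tree, so each \<open>w\<close> occurs at most once. This
  keeps the union over the \<open>m\<close> stages of the path from costing a factor \<open>m\<close>.
\<close>

lemma sum_add_branch_le:
  fixes F :: "ctree \<Rightarrow> real"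
  assumes "r \<ge> 1" "\<And>w. 0 \<le> F w"
  shows "(\<Sum>k<m. \<Sum>z\<in>coloured_trees r k. \<Sum>x\<in>coloured_trees r (m - 1 - k). F (add_branch 1 z x)) \<le>
    (\<Sum>w\<in>coloured_trees r m. F w)"
proof -
  let ?I = "SIGMA k:{..<m}. coloured_trees r k \<times> coloured_trees r (m - 1 - k)"
  let ?j = "\<lambda>(k::nat, z, x). add_branch 1 z x"
  have "(\<Sum>k<m. \<Sum>z\<in>coloured_trees r k. \<Sum>x\<in>coloured_trees r (m - 1 - k). F (add_branch 1 z x)) =
      (\<Sum>i\<in>?I. F (?j i))"
    unfolding sum.cartesian_product by (subst sum.Sigma) (auto simp: case_prod_beta)
  also have "\<dots> = sum F (?j ` ?I)"
    by (subst sum.reindex) (auto simp: inj_on_def mem_coloured_trees)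
  also have "\<dots> \<le> sum F (coloured_trees r m)"
    using assms by (intro sum_mono2) (auto simp: mem_coloured_trees)
  finally show ?thesis .
qed

text \<open>
  The final tree of \<open>g\<close> is independent of that of \<open>h\<close>, so \<open>f\<close> at the end of the path serves as a constant
  approximating \<open>f\<close> at its uniform beginning. The bound \<open>B\<close> controls the probability of meeting a given \<open>w\<close> at stage
  \<open>k\<close>.
\<close>

lemma variance_le_leaf_energy:
  assumes "r \<ge> 1" "B \<ge> 0"
    and B: "\<And>k. k < m \<Longrightarrow>
      1 / (real (card (coloured_trees r k)) * card (coloured_trees r (m - 1 - k))) \<le> B"
  shows "measure_pmf.variance (pmf_of_set (coloured_trees r (Suc m))) f \<le>
    4 * (real m + 1)\<^sup>2 * (1 / card (coloured_trees r m) + B) *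
      (\<Sum>w\<in>coloured_trees r m. leaf_energy r f w)"
proof -
  let ?T = "coloured_trees r" and ?N = "\<lambda>k. real (card (coloured_trees r k))"
  let ?H = "growth_history r (Suc m)" and ?G = "growth_history r m"
  let ?V = "measure_pmf.variance (pmf_of_set (?T (Suc m))) f"
  let ?W = "leaf_energy r f"
  let ?A = "4 * (real m + 1)\<^sup>2"
  note fin = finite_growth_history[OF assms(1)]
  note int = integrable_measure_pmf_finite[OF fin]
  have "?V = measure_pmf.expectation ?G (\<lambda>g. ?V)"
    by simp
  also have "\<dots> \<le> measure_pmf.expectation ?G (\<lambda>g.
      measure_pmf.expectation ?H (\<lambda>h. (f (h (Suc m)) - f (add_branch 1 (g m) (Node [])))\<^sup>2))"
  proof (rule pmf_expectation_mono[OF fin])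
    fix g
    have "measure_pmf.expectation ?H (\<lambda>h. (f (h (Suc m)) - f (add_branch 1 (g m) (Node [])))\<^sup>2) =
        (\<Sum>x\<in>?T (Suc m). (f x - f (add_branch 1 (g m) (Node [])))\<^sup>2) / ?N (Suc m)"
      using expectation_growth_history[OF assms(1), of "Suc m" "Suc m" "\<lambda>x. (f x - f (add_branch 1 (g m) (Node [])))\<^sup>2"]
      by simp
    then show "?V \<le> measure_pmf.expectation ?H (\<lambda>h. (f (h (Suc m)) - f (add_branch 1 (g m) (Node [])))\<^sup>2)"
      using variance_pmf_of_set_le[of "?T (Suc m)" f "f (add_branch 1 (g m) (Node []))"]
        coloured_trees_nonempty[OF assms(1)] by simp
  qed
  also have "\<dots> \<le> measure_pmf.expectation ?G (\<lambda>g. measure_pmf.expectation ?H (\<lambda>h.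
      ?A * (?W (h m) + (\<Sum>k<m. ?W (add_branch 1 (g k) (h (m - 1 - k)))))))"
    using history_path_energy[OF assms(1)] by (intro pmf_expectation_mono fin)
  also have "\<dots> = ?A * (measure_pmf.expectation ?H (\<lambda>h. ?W (h m)) +
      (\<Sum>k<m. measure_pmf.expectation ?G (\<lambda>g. measure_pmf.expectation ?H (\<lambda>h. ?W (add_branch 1 (g k) (h (m - 1 - k)))))))"
    by (simp add: int Bochner_Integration.integral_add Bochner_Integration.integral_sum del: growth_history.simps)
  also have "\<dots> \<le> ?A * (sum ?W (?T m) / ?N m + B * sum ?W (?T m))"
  proof (intro mult_left_mono add_mono)
    show "measure_pmf.expectation ?H (\<lambda>h. ?W (h m)) \<le> sum ?W (?T m) / ?N m"
      using expectation_growth_history[OF assms(1), of m "Suc m" ?W] by simp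
    have "measure_pmf.expectation ?G (\<lambda>g. measure_pmf.expectation ?H (\<lambda>h. ?W (add_branch 1 (g k) (h (m - 1 - k)))))
        \<le> B * (\<Sum>z\<in>?T k. \<Sum>x\<in>?T (m - 1 - k). ?W (add_branch 1 z x))" if "k < m" for k
    proof -
      have "measure_pmf.expectation ?G (\<lambda>g. measure_pmf.expectation ?H (\<lambda>h. ?W (add_branch 1 (g k) (h (m - 1 - k))))) =
          measure_pmf.expectation ?G (\<lambda>g. (\<Sum>x\<in>?T (m - 1 - k). ?W (add_branch 1 (g k) x)) / ?N (m - 1 - k))"
        using that expectation_growth_history[OF assms(1), of "m - 1 - k" "Suc m" "\<lambda>x. ?W (add_branch 1 (g k) x)" for g]
        by (simp del: growth_history.simps)
      also have "\<dots> = (\<Sum>z\<in>?T k. (\<Sum>x\<in>?T (m - 1 - k). ?W (add_branch 1 z x)) / ?N (m - 1 - k)) / ?N k"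
        using that expectation_growth_history[OF assms(1), of k m
            "\<lambda>z. (\<Sum>x\<in>?T (m - 1 - k). ?W (add_branch 1 z x)) / ?N (m - 1 - k)"]
        by simp
      also have "\<dots> = 1 / (?N k * ?N (m - 1 - k)) * (\<Sum>z\<in>?T k. \<Sum>x\<in>?T (m - 1 - k). ?W (add_branch 1 z x))"
        by (simp add: sum_divide_distrib[symmetric])
      also have "\<dots> \<le> B * (\<Sum>z\<in>?T k. \<Sum>x\<in>?T (m - 1 - k). ?W (add_branch 1 z x))"
        by (intro mult_right_mono B that sum_nonneg leaf_energy_nonneg)
      finally show ?thesis .
    qed
    then have "(\<Sum>k<m. measure_pmf.expectation ?G (\<lambda>g. measure_pmf.expectation ?H (\<lambda>h. ?W (add_branch 1 (g k) (h (m - 1 - k))))))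
        \<le> (\<Sum>k<m. B * (\<Sum>z\<in>?T k. \<Sum>x\<in>?T (m - 1 - k). ?W (add_branch 1 z x)))"
      by (intro sum_mono) auto
    also have "\<dots> \<le> B * sum ?W (?T m)"
      unfolding sum_distrib_left[symmetric]
      by (intro mult_left_mono sum_add_branch_le assms leaf_energy_nonneg)
    finally show "(\<Sum>k<m. measure_pmf.expectation ?G (\<lambda>g. measure_pmf.expectation ?H (\<lambda>h. ?W (add_branch 1 (g k) (h (m - 1 - k))))))
        \<le> B * sum ?W (?T m)" .
  qed simp
  also have "\<dots> = ?A * (1 / ?N m + B) * sum ?W (?T m)"
    by (simp add: algebra_simps)
  finally show ?thesis .
qed

section \<open>The number of coloured trees\<close>

text \<open>
  With \<open>r = 1\<close> this is \<open>C\<^sub>n \<le> 4\<^sup>n (n + 1)\<^bsup>-3/2\<^esup>\<close> for the Catalan number \<open>C\<^sub>n\<close>, squared to avoid roots. The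
  quotient of the two sides is monotone in \<open>n\<close>, which gives the induction.
\<close>

lemma card_coloured_trees_upper:
  assumes "r \<ge> 1"
  shows "(real (card (coloured_trees r n)))\<^sup>2 * (real n + 1) ^ 3 \<le> (4 * real r) ^ (2 * n)"
proof (induction n)
  case (Suc n)
  let ?N = "real (card (coloured_trees r n))"
  have "(growth_ratio n)\<^sup>2 * (real n + 2) ^ 3 \<le> 16 * (real n + 1) ^ 3"
  proof -
    have "(growth_ratio n)\<^sup>2 * (real n + 2) ^ 3 = (4 * real n + 2)\<^sup>2 * (real n + 2)"
      by (simp add: growth_ratio_def power_divide power2_eq_square power3_eq_cube)
    also have "\<dots> \<le> 16 * (real n + 1) ^ 3"
      by (simp add: power2_eq_square power3_eq_cube algebra_simps)
    finally show ?thesis .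
  qed
  then have "?N\<^sup>2 * (real r)\<^sup>2 * ((growth_ratio n)\<^sup>2 * (real n + 2) ^ 3) \<le> ?N\<^sup>2 * (real r)\<^sup>2 * (16 * (real n + 1) ^ 3)"
    by (intro mult_left_mono) auto
  also have "\<dots> = (16 * (real r)\<^sup>2) * (?N\<^sup>2 * (real n + 1) ^ 3)"
    by simp
  also have "\<dots> \<le> (16 * (real r)\<^sup>2) * (4 * real r) ^ (2 * n)"
    using Suc.IH by (intro mult_left_mono) auto
  finally show ?case
    by (simp add: card_coloured_trees_Suc[OF assms] power_mult_distrib power2_eq_square mult_ac add.commute)
qed simp

text \<open>
  Similarly \<open>C\<^sub>n \<ge> 4\<^sup>n (2 n + 1)\<^bsup>-3/2\<^esup>\<close>. The shift matters: with \<open>(n + 1)\<^bsup>-3/2\<^esup>\<close> the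
  quotient of the two sides would be monotone in the other direction.
\<close>

lemma card_coloured_trees_lower:
  assumes "r \<ge> 1"
  shows "(4 * real r) ^ (2 * n) \<le> (real (card (coloured_trees r n)))\<^sup>2 * (2 * real n + 1) ^ 3"
proof (induction n)
  case (Suc n)
  let ?N = "real (card (coloured_trees r n))"
  have "16 * (2 * real n + 1) ^ 3 \<le> (growth_ratio n)\<^sup>2 * (2 * real n + 3) ^ 3"
  proof -
    have "16 * (2 * real n + 1) ^ 3 * (real n + 2)\<^sup>2 \<le> (4 * real n + 2)\<^sup>2 * (2 * real n + 3) ^ 3"
      by (simp add: power2_eq_square power3_eq_cube algebra_simps)
    then show ?thesis
      by (simp add: growth_ratio_def power_divide pos_le_divide_eq)
  qed
  then have "?N\<^sup>2 * (real r)\<^sup>2 * (16 * (2 * real n + 1) ^ 3) \<le> ?N\<^sup>2 * (real r)\<^sup>2 * ((growth_ratio n)\<^sup>2 * (2 * real n + 3) ^ 3)"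
    by (intro mult_left_mono) auto
  moreover have "(16 * (real r)\<^sup>2) * (4 * real r) ^ (2 * n) \<le> (16 * (real r)\<^sup>2) * (?N\<^sup>2 * (2 * real n + 1) ^ 3)"
    using Suc.IH by (intro mult_left_mono) auto
  ultimately have "(16 * (real r)\<^sup>2) * (4 * real r) ^ (2 * n) \<le>
      ?N\<^sup>2 * (real r)\<^sup>2 * ((growth_ratio n)\<^sup>2 * (2 * real n + 3) ^ 3)"
    by (simp only: mult_ac)
  then show ?case
    by (simp add: card_coloured_trees_Suc[OF assms] power_mult_distrib power2_eq_square mult_ac add.commute)
qed simp

text \<open>
  The worst case is a balanced split, where \<open>((2 k + 1) (2 j + 1) / (n + 1))\<^bsup>3/2\<^esup>\<close> is of order \<open>n\<^bsup>3/2\<^esup>\<close>.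
\<close>

lemma card_coloured_trees_split:
  assumes "r \<ge> 1" "k + j + 2 = n"
  shows "real (card (coloured_trees r n)) \<le>
    16 * (real r)\<^sup>2 * real n powr (3 / 2) * (real (card (coloured_trees r k)) * card (coloured_trees r j))"
proof (rule power2_le_imp_le)
  let ?N = "\<lambda>k. real (card (coloured_trees r k))"
  define X where "X = (?N k)\<^sup>2 * (?N j)\<^sup>2"
  have n: "real n = k + j + 2" using assms(2) by simp
  have sides: "(2 * real k + 1) * (2 * real j + 1) \<le> real n * (real n + 1)"
    using sum_squares_bound[of "real k" "real j"]
    unfolding n by (simp add: power2_eq_square algebra_simps)
  have "(?N n)\<^sup>2 * (real n + 1) ^ 3 \<le> (4 * real r) ^ (2 * n)"
    by (rule card_coloured_trees_upper[OF assms(1)])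
  also have "\<dots> = (4 * real r) ^ 4 * ((4 * real r) ^ (2 * k) * (4 * real r) ^ (2 * j))"
  proof -
    have "2 * n = 4 + (2 * k + 2 * j)" using assms(2) by simp
    then show ?thesis by (simp only: power_add)
  qed
  also have "\<dots> \<le> (4 * real r) ^ 4 * (((?N k)\<^sup>2 * (2 * real k + 1) ^ 3) * ((?N j)\<^sup>2 * (2 * real j + 1) ^ 3))"
    by (intro mult_left_mono mult_mono card_coloured_trees_lower[OF assms(1)]) auto
  also have "\<dots> = (4 * real r) ^ 4 * X * ((2 * real k + 1) * (2 * real j + 1)) ^ 3"
    by (simp add: X_def power_mult_distrib)
  also have "\<dots> \<le> (4 * real r) ^ 4 * X * (real n * (real n + 1)) ^ 3"
    by (intro mult_left_mono power_mono sides) (auto simp: X_def)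
  also have "\<dots> = ((4 * real r) ^ 4 * X * real n ^ 3) * (real n + 1) ^ 3"
    by (simp add: power_mult_distrib)
  finally have "(?N n)\<^sup>2 \<le> (4 * real r) ^ 4 * X * real n ^ 3"
    by simp
  moreover have "(real n powr (3 / 2))\<^sup>2 = real n ^ 3"
    using n by (simp add: powr_power powr_numeral)
  ultimately show "(?N n)\<^sup>2 \<le> (16 * (real r)\<^sup>2 * real n powr (3 / 2) * (?N k * ?N j))\<^sup>2"
    by (simp add: power_mult_distrib X_def power4_eq_xxxx power2_eq_square mult_ac)
qed simp

section \<open>The spectral gap\<close>

lemma poincare_inequality:
  assumes "r \<ge> 1" "n \<ge> 1"
  shows "measure_pmf.variance (pmf_of_set (coloured_trees r n)) f \<le>
    160 * (real r)\<^sup>2 * (r + 2) * real n powr (9 / 2) *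
    dirichlet_form (coloured_trees r n) (pmf_of_set (coloured_trees r n)) (leaf_translation_chain r) f"
proof -
  obtain m where n: "n = Suc m" using assms(2) by (cases n) auto
  let ?N = "\<lambda>k. real (card (coloured_trees r k))"
  let ?W = "\<Sum>w\<in>coloured_trees r m. leaf_energy r f w"
  let ?D = "dirichlet_form (coloured_trees r n) (pmf_of_set (coloured_trees r n)) (leaf_translation_chain r) f"
  have N: "?N k > 0" for k
    using card_coloured_trees_pos[OF assms(1)] by simp
  have m: "real m + 1 = real n" by (simp add: n)
  have r: "real r \<ge> 1" using assms(1) by simp
  have root: "real n powr (3 / 2) \<ge> 1"
    using assms(2) by (intro ge_one_powr_ge_zero) auto
  define B where "B = 16 * (real r)\<^sup>2 * real n powr (3 / 2) / ?N n"
  have "1 / (?N k * ?N (m - 1 - k)) \<le> B" if "k < m" for k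
    using card_coloured_trees_split[OF assms(1), of k "m - 1 - k" n] that N[of k] N[of n] N[of "m - 1 - k"] n
    by (simp add: B_def field_simps)
  then have "measure_pmf.variance (pmf_of_set (coloured_trees r n)) f \<le>
      4 * (real m + 1)\<^sup>2 * (1 / ?N m + B) * ?W"
    unfolding n by (intro variance_le_leaf_energy assms) (auto simp: B_def)
  also have "\<dots> \<le> 4 * (real m + 1)\<^sup>2 * (20 * (real r)\<^sup>2 * real n powr (3 / 2) / ?N n) * ?W"
  proof (intro mult_right_mono mult_left_mono)
    have "growth_ratio m \<le> 4"
      by (simp add: growth_ratio_def divide_le_eq)
    then have "?N n / ?N m \<le> 4 * real r"
      unfolding n card_coloured_trees_Suc[OF assms(1)] using N[of m] r by (simp add: mult.commute)
    also have "\<dots> \<le> 4 * (real r)\<^sup>2 * real n powr (3 / 2)"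
      using mult_mono[of "real r" "(real r)\<^sup>2" 1 "real n powr (3 / 2)"] r root
      by (simp add: power2_eq_square)
    finally have "1 / ?N m \<le> 4 * (real r)\<^sup>2 * real n powr (3 / 2) / ?N n"
      using N[of m] N[of n] by (simp add: field_simps)
    then show "1 / ?N m + B \<le> 20 * (real r)\<^sup>2 * real n powr (3 / 2) / ?N n"
      by (simp add: B_def add_divide_distrib[symmetric])
  qed (auto intro: sum_nonneg leaf_energy_nonneg)
  also have "\<dots> \<le> 4 * (real m + 1)\<^sup>2 * (20 * (real r)\<^sup>2 * real n powr (3 / 2) / ?N n) *
      (2 * ?N n * n * (r + 2) * ?D)"
  proof (intro mult_left_mono)
    show "?W \<le> 2 * ?N n * n * (r + 2) * ?D"
      using sum_leaf_energy_le_dirichlet_form[OF assms(1), of f m] unfolding n[symmetric]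
      by (simp only: of_nat_mult of_nat_add of_nat_numeral)
  qed simp
  also have "\<dots> = 160 * (real r)\<^sup>2 * (r + 2) * (real n ^ 3 * real n powr (3 / 2)) * ?D"
  proof -
    have "4 * x\<^sup>2 * (20 * R * P / X) * (2 * X * x * q * D) = 160 * R * q * (x ^ 3 * P) * D"
      if "X > 0" for x R P X q D :: real
      using that by (simp add: power2_eq_square power3_eq_cube)
    from this[OF N[of n]] show ?thesis
      unfolding m .
  qed
  also have "real n ^ 3 * real n powr (3 / 2) = real n powr (9 / 2)"
  proof -
    have "real n ^ 3 = real n powr 3"
      using assms(2) by (simp add: powr_numeral)
    then show ?thesis
      by (simp only: powr_add[symmetric]) simp
  qed
  finally show ?thesis .
qed

theorem theorem4:
  fixes r :: nat
  assumes "r \<ge> 1"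
  shows "\<exists>C::real. C > 0 \<and> (\<forall>n::nat. n \<ge> 1 \<longrightarrow>
    spectral_gap (coloured_trees r n) (pmf_of_set (coloured_trees r n)) (leaf_translation_chain r)
      \<ge> ereal (C * real n powr (- (9 / 2))))"
proof (intro exI[of _ "1 / (160 * (real r)\<^sup>2 * (r + 2))"] conjI allI impI)
  show "1 / (160 * (real r)\<^sup>2 * (r + 2)) > 0"
    using assms by simp
  fix n :: nat
  assume n: "n \<ge> 1"
  let ?\<Omega> = "coloured_trees r n"
  let ?D = "dirichlet_form ?\<Omega> (pmf_of_set ?\<Omega>) (leaf_translation_chain r)"
  let ?V = "measure_pmf.variance (pmf_of_set ?\<Omega>)"
  show "spectral_gap ?\<Omega> (pmf_of_set ?\<Omega>) (leaf_translation_chain r) \<ge>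
      ereal (1 / (160 * (real r)\<^sup>2 * (r + 2)) * real n powr (- (9 / 2)))"
    unfolding spectral_gap_def
  proof (rule INF_greatest)
    fix f :: "ctree \<Rightarrow> real"
    assume "f \<in> {f. \<exists>x\<in>?\<Omega>. \<exists>y\<in>?\<Omega>. f x \<noteq> f y}"
    then have V: "?V f > 0"
      using variance_pmf_of_set_pos[OF finite_coloured_trees] by blast
    define K where "K = 160 * (real r)\<^sup>2 * (r + 2) * real n powr (9 / 2)"
    have "K > 0" using assms n by (simp add: K_def)
    moreover have "?V f \<le> K * ?D f"
      unfolding K_def by (rule poincare_inequality[OF assms n])
    ultimately have "1 / K \<le> ?D f / ?V f"
      using V by (simp add: field_simps)
    moreover have "1 / K = 1 / (160 * (real r)\<^sup>2 * (r + 2)) * real n powr (- (9 / 2))"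
      by (simp add: K_def powr_minus_divide)
    ultimately show "ereal (1 / (160 * (real r)\<^sup>2 * (r + 2)) * real n powr (- (9 / 2))) \<le> ereal (?D f / ?V f)"
      by simp
  qed
qed

end
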